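(* Let $\mathcal{Q}$ be a finite classical polar space of rank $r\ge 1$ and type $Q$ over $\mathbb{F}_q$, let $1\le t\le k\le r$, let $D$ be a $t$-$(r,k,\lambda)_Q$ design in $\mathcal{Q}$, and let $P$ be a point (1-dimensional subspace) of $\mathcal{Q}$. Then the derived design of $D$ in $P$, $$\operatorname{Der}_P(D)=\{B/P\mid B\in D,\ P\subseteq B\},$$ is a $(t-1)$-$(r-1,k-1,\lambda)_Q$ design in the polar space $P^\perp/P$.
   Context: Let $q$ be a prime power. A finite classical polar space $\mathcal{Q}$ over $\mathbb{F}_q$ consists of all subspaces of a finite-dimensional $\mathbb{F}_q$-vector space $V$, $n=\dim V$, that are totally isotropic (resp. totally singular) with respect to a non-degenerate alternating or Hermitian form (resp. a non-singular quadratic form) on $V$. All dimensions are vector space dimensions. The rank $r$ is the maximal dimension of a subspace in $\mathcal{Q}$. The type $Q$ of $\mathcal{Q}$ (kind of form together with $q$) is one of: symplectic $\mathrm{Sp}(q)$ ($n=2r$); Hermitian $U^+(q)$ ($q$ a square, $n=2r$); Hermitian $U^-(q)$ ($q$ a square, $n=2r+1$); hyperbolic $\Omega^+(q)$ ($n=2r$); parabolic $\Omega(q)$ ($n=2r+1$); elliptic $\Omega^-(q)$ ($n=2r+2$). For a subspace $U$ of $\mathcal{Q}$, $U^\perp$ is the orthogonal subspace of $U$ in $V$ with respect to the underlying form (for a quadratic form, its associated bilinear form). For a point $P$ of $\mathcal{Q}$, $P^\perp/P$ denotes the polar space with ambient vector space $P^\perp/P$ and the induced form; its subspaces are exactly the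 quotients $U/P$ with $U$ a subspace of $\mathcal{Q}$ containing $P$, and it is of the same type $Q$ and of rank $r-1$ (if $r=1$, it is the rank-$0$ polar space whose only subspace is the zero space). For $t,k\in\{0,\ldots,r\}$ and an integer $\lambda\ge 0$, a $t$-$(r,k,\lambda)_Q$ design in a polar space $\mathcal{Q}$ of rank $r$ and type $Q$ is a set $D$ of $k$-dimensional subspaces of $\mathcal{Q}$ (called blocks) such that every $t$-dimensional subspace of $\mathcal{Q}$ is contained in exactly $\lambda$ elements of $D$. *)

theory Defs
  imports "HOL-Algebra.QuotRing" "Jordan_Normal_Form.Missing_VectorSpace"
begin

section \<open>Forms\<close>

text \<open>\<^term>\<open>sesquilinear_form K V \<sigma> B\<close>: linear in the first argument and \<open>\<sigma>\<close>-semilinear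
  in the second.\<close>

definition sesquilinear_form ::
  "('k, 'm) ring_scheme \<Rightarrow> ('k, 'v, 'n) module_scheme \<Rightarrow> ('k \<Rightarrow> 'k) \<Rightarrow> ('v \<Rightarrow> 'v \<Rightarrow> 'k) \<Rightarrow> bool"
where
  "sesquilinear_form K V \<sigma> B \<longleftrightarrow>
     (\<forall>u\<in>carrier V. \<forall>v\<in>carrier V. B u v \<in> carrier K) \<and>
     (\<forall>u\<in>carrier V. \<forall>v\<in>carrier V. \<forall>w\<in>carrier V.
        B (u \<oplus>\<^bsub>V\<^esub> v) w = B u w \<oplus>\<^bsub>K\<^esub> B v w \<and> B u (v \<oplus>\<^bsub>V\<^esub> w) = B u v \<oplus>\<^bsub>K\<^esub> B u w) \<and>
     (\<forall>a\<in>carrier K. \<forall>u\<in>carrier V. \<forall>v\<in>carrier V.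
        B (a \<odot>\<^bsub>V\<^esub> u) v = a \<otimes>\<^bsub>K\<^esub> B u v \<and> B u (a \<odot>\<^bsub>V\<^esub> v) = \<sigma> a \<otimes>\<^bsub>K\<^esub> B u v)"

abbreviation bilinear_form ::
  "('k, 'm) ring_scheme \<Rightarrow> ('k, 'v, 'n) module_scheme \<Rightarrow> ('v \<Rightarrow> 'v \<Rightarrow> 'k) \<Rightarrow> bool" where
  "bilinear_form K V B \<equiv> sesquilinear_form K V (\<lambda>a. a) B"

definition alternating_form ::
  "('k, 'm) ring_scheme \<Rightarrow> ('k, 'v, 'n) module_scheme \<Rightarrow> ('v \<Rightarrow> 'v \<Rightarrow> 'k) \<Rightarrow> bool" where
  "alternating_form K V B \<longleftrightarrow> bilinear_form K V B \<and> (\<forall>v\<in>carrier V. B v v = \<zero>\<^bsub>K\<^esub>)"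

definition hermitian_form ::
  "('k, 'm) ring_scheme \<Rightarrow> ('k, 'v, 'n) module_scheme \<Rightarrow> ('v \<Rightarrow> 'v \<Rightarrow> 'k) \<Rightarrow> bool" where
  "hermitian_form K V B \<longleftrightarrow>
     (\<exists>\<sigma>\<in>ring_iso K K.
        (\<forall>a\<in>carrier K. \<sigma> (\<sigma> a) = a) \<and> (\<exists>a\<in>carrier K. \<sigma> a \<noteq> a) \<and>
        sesquilinear_form K V \<sigma> B \<and>
        (\<forall>u\<in>carrier V. \<forall>v\<in>carrier V. B v u = \<sigma> (B u v)))"

definition polarization ::
  "('k, 'm) ring_scheme \<Rightarrow> ('k, 'v, 'n) module_scheme \<Rightarrow> ('v \<Rightarrow> 'k) \<Rightarrow> 'v \<Rightarrow> 'v \<Rightarrow> 'k" where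
  "polarization K V f u v = f (u \<oplus>\<^bsub>V\<^esub> v) \<ominus>\<^bsub>K\<^esub> f u \<ominus>\<^bsub>K\<^esub> f v"

definition quadratic_form ::
  "('k, 'm) ring_scheme \<Rightarrow> ('k, 'v, 'n) module_scheme \<Rightarrow> ('v \<Rightarrow> 'k) \<Rightarrow> bool" where
  "quadratic_form K V f \<longleftrightarrow>
     (\<forall>v\<in>carrier V. f v \<in> carrier K) \<and>
     (\<forall>a\<in>carrier K. \<forall>v\<in>carrier V. f (a \<odot>\<^bsub>V\<^esub> v) = a [^]\<^bsub>K\<^esub> (2::nat) \<otimes>\<^bsub>K\<^esub> f v) \<and>
     bilinear_form K V (polarization K V f)"

datatype ('k, 'v) form =
    is_Alternating: Alternating "'v \<Rightarrow> 'v \<Rightarrow> 'k"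
  | is_Hermitian: Hermitian "'v \<Rightarrow> 'v \<Rightarrow> 'k"
  | is_Quadratic: Quadratic "'v \<Rightarrow> 'k"

fun wf_form ::
  "('k, 'm) ring_scheme \<Rightarrow> ('k, 'v, 'n) module_scheme \<Rightarrow> ('k, 'v) form \<Rightarrow> bool" where
  "wf_form K V (Alternating B) = alternating_form K V B"
| "wf_form K V (Hermitian B) = hermitian_form K V B"
| "wf_form K V (Quadratic f) = quadratic_form K V f"

fun pairing ::
  "('k, 'm) ring_scheme \<Rightarrow> ('k, 'v, 'n) module_scheme \<Rightarrow> ('k, 'v) form \<Rightarrow> 'v \<Rightarrow> 'v \<Rightarrow> 'k" where
  "pairing K V (Alternating B) = B"
| "pairing K V (Hermitian B) = B"
| "pairing K V (Quadratic f) = polarization K V f"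

definition perp ::
  "('k, 'm) ring_scheme \<Rightarrow> ('k, 'v, 'n) module_scheme \<Rightarrow> ('k, 'v) form \<Rightarrow> 'v set \<Rightarrow> 'v set" where
  "perp K V F U = {v \<in> carrier V. \<forall>u\<in>U. pairing K V F u v = \<zero>\<^bsub>K\<^esub>}"

text \<open>Non-singularity of a quadratic form is weaker than non-degeneracy of its polarization:
  in characteristic 2 the latter always has a nonzero radical if the dimension is odd. Only
  singular vectors are excluded from the radical.\<close>

fun nondegenerate ::
  "('k, 'm) ring_scheme \<Rightarrow> ('k, 'v, 'n) module_scheme \<Rightarrow> ('k, 'v) form \<Rightarrow> bool" where
  "nondegenerate K V (Quadratic f) \<longleftrightarrow>
     {v \<in> perp K V (Quadratic f) (carrier V). f v = \<zero>\<^bsub>K\<^esub>} = {\<zero>\<^bsub>V\<^esub>}"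
| "nondegenerate K V F \<longleftrightarrow> perp K V F (carrier V) = {\<zero>\<^bsub>V\<^esub>}"

section \<open>Polar spaces\<close>

fun totally_isotropic :: "('k, 'm) ring_scheme \<Rightarrow> ('k, 'v) form \<Rightarrow> 'v set \<Rightarrow> bool" where
  "totally_isotropic K (Alternating B) U \<longleftrightarrow> (\<forall>u\<in>U. \<forall>v\<in>U. B u v = \<zero>\<^bsub>K\<^esub>)"
| "totally_isotropic K (Hermitian B) U \<longleftrightarrow> (\<forall>u\<in>U. \<forall>v\<in>U. B u v = \<zero>\<^bsub>K\<^esub>)"
| "totally_isotropic K (Quadratic f) U \<longleftrightarrow> (\<forall>u\<in>U. f u = \<zero>\<^bsub>K\<^esub>)"

definition polar_subspaces ::
  "('k, 'm) ring_scheme \<Rightarrow> ('k, 'v, 'n) module_scheme \<Rightarrow> ('k, 'v) form \<Rightarrow> 'v set set" where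
  "polar_subspaces K V F = {U. subspace K U V \<and> totally_isotropic K F U}"

definition sdim ::
  "('k, 'm) ring_scheme \<Rightarrow> ('k, 'v, 'n) module_scheme \<Rightarrow> 'v set \<Rightarrow> nat" where
  "sdim K V U = vectorspace.dim K (V\<lparr>carrier := U\<rparr>)"

definition polar_subspaces_dim ::
  "('k, 'm) ring_scheme \<Rightarrow> ('k, 'v, 'n) module_scheme \<Rightarrow> ('k, 'v) form \<Rightarrow> nat \<Rightarrow> 'v set set" where
  "polar_subspaces_dim K V F d = {U \<in> polar_subspaces K V F. sdim K V U = d}"

definition polar_rank ::
  "('k, 'm) ring_scheme \<Rightarrow> ('k, 'v, 'n) module_scheme \<Rightarrow> ('k, 'v) form \<Rightarrow> nat" where
  "polar_rank K V F = Max (sdim K V ` polar_subspaces K V F)"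

text \<open>The argument of each constructor is the order of the field.\<close>

datatype polar_type =
  Sp nat | U_plus nat | U_minus nat | Omega_plus nat | Omega nat | Omega_minus nat

fun has_type ::
  "('k, 'm) ring_scheme \<Rightarrow> ('k, 'v, 'n) module_scheme \<Rightarrow> ('k, 'v) form \<Rightarrow> polar_type \<Rightarrow> bool"
where
  "has_type K V F (Sp q) \<longleftrightarrow>
     order K = q \<and> is_Alternating F \<and> vectorspace.dim K V = 2 * polar_rank K V F"
| "has_type K V F (U_plus q) \<longleftrightarrow>
     order K = q \<and> (\<exists>s. q = s ^ 2) \<and> is_Hermitian F \<and>
     vectorspace.dim K V = 2 * polar_rank K V F"
| "has_type K V F (U_minus q) \<longleftrightarrow>
     order K = q \<and> (\<exists>s. q = s ^ 2) \<and> is_Hermitian F \<and>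
     vectorspace.dim K V = 2 * polar_rank K V F + 1"
| "has_type K V F (Omega_plus q) \<longleftrightarrow>
     order K = q \<and> is_Quadratic F \<and> vectorspace.dim K V = 2 * polar_rank K V F"
| "has_type K V F (Omega q) \<longleftrightarrow>
     order K = q \<and> is_Quadratic F \<and> vectorspace.dim K V = 2 * polar_rank K V F + 1"
| "has_type K V F (Omega_minus q) \<longleftrightarrow>
     order K = q \<and> is_Quadratic F \<and> vectorspace.dim K V = 2 * polar_rank K V F + 2"

definition polar_space ::
  "('k, 'm) ring_scheme \<Rightarrow> ('k, 'v, 'n) module_scheme \<Rightarrow> ('k, 'v) form \<Rightarrow>
   polar_type \<Rightarrow> nat \<Rightarrow> bool"
where
  "polar_space K V F Q r \<longleftrightarrow>
     vectorspace K V \<and> finite (carrier K) \<and> vectorspace.fin_dim K V \<and>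
     wf_form K V F \<and> nondegenerate K V F \<and> has_type K V F Q \<and> polar_rank K V F = r"

section \<open>Designs\<close>

text \<open>The sets counted by \<^const>\<open>card\<close> are finite, because the ambient space of a polar space is
  a finite set.\<close>

definition polar_design ::
  "('k, 'm) ring_scheme \<Rightarrow> ('k, 'v, 'n) module_scheme \<Rightarrow> ('k, 'v) form \<Rightarrow> polar_type \<Rightarrow>
   nat \<Rightarrow> nat \<Rightarrow> nat \<Rightarrow> nat \<Rightarrow> 'v set set \<Rightarrow> bool"
where
  "polar_design K V F Q t r k l D \<longleftrightarrow>
     polar_space K V F Q r \<and> t \<le> r \<and> k \<le> r \<and>
     D \<subseteq> polar_subspaces_dim K V F k \<and>
     (\<forall>T \<in> polar_subspaces_dim K V F t. card {B \<in> D. T \<subseteq> B} = l)"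

section \<open>The polar space at a point\<close>

text \<open>\<open>U/W\<close> is the set of cosets of \<open>W\<close> by elements of \<open>U\<close>.\<close>

definition quotient_set :: "('k, 'v, 'n) module_scheme \<Rightarrow> 'v set \<Rightarrow> 'v set \<Rightarrow> 'v set set" where
  "quotient_set V U W = a_rcosets\<^bsub>V\<lparr>carrier := U\<rparr>\<^esub> W"

text \<open>The fields \<open>mult\<close> and \<open>one\<close> are inherited from the ring record and have no meaning
  in a vector space.\<close>

definition quotient_space ::
  "('k, 'v, 'n) module_scheme \<Rightarrow> 'v set \<Rightarrow> ('k, 'v set) module" where
  "quotient_space V W =
     \<lparr>carrier = quotient_set V (carrier V) W,
      mult = (\<lambda>X Y. W), one = W,
      zero = W, add = (\<lambda>X Y. X <+>\<^bsub>V\<^esub> Y),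
      smult = (\<lambda>a X. W <+>\<^bsub>V\<^esub> ((\<lambda>x. a \<odot>\<^bsub>V\<^esub> x) ` X))\<rparr>"

text \<open>The value of the induced form on cosets is the common value of the form on all
  representatives.\<close>

fun induced_form :: "('k, 'v) form \<Rightarrow> ('k, 'v set) form" where
  "induced_form (Alternating B) = Alternating (\<lambda>X Y. the_elem ((\<lambda>(x, y). B x y) ` (X \<times> Y)))"
| "induced_form (Hermitian B) = Hermitian (\<lambda>X Y. the_elem ((\<lambda>(x, y). B x y) ` (X \<times> Y)))"
| "induced_form (Quadratic f) = Quadratic (\<lambda>X. the_elem (f ` X))"

definition residue_space ::
  "('k, 'm) ring_scheme \<Rightarrow> ('k, 'v, 'n) module_scheme \<Rightarrow> ('k, 'v) form \<Rightarrow> 'v set \<Rightarrow>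
   ('k, 'v set) module"
where
  "residue_space K V F P = quotient_space (V\<lparr>carrier := perp K V F P\<rparr>) P"

definition derived_design ::
  "('k, 'v, 'n) module_scheme \<Rightarrow> 'v set \<Rightarrow> 'v set set \<Rightarrow> 'v set set set" where
  "derived_design V P D = {quotient_set V B P | B. B \<in> D \<and> P \<subseteq> B}"

end

theory Submission
  imports Defs
begin

text \<open>The three kinds of forms are treated uniformly through the pairing \<open>b\<close> and the set of singular
  vectors: a subspace is in the polar space iff its vectors are singular and pairwise orthogonal,
  and nondegeneracy says that \<open>0\<close> is the only singular vector of the radical. Since the point
  \<open>P\<close> is singular, \<open>b\<close> and singularity are constant on the cosets of \<open>P\<close> in the hyperplane
  \<open>W = P\<^sup>\<bottom>\<close>, so \<open>U \<mapsto> U/P\<close> is an inclusion-preserving bijection from the subspaces of the polar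
  space through \<open>P\<close> onto those of \<open>P\<^sup>\<bottom>/P\<close> that lowers dimensions by one; the design property is
  transported along it. The rank drops by exactly one because a maximal subspace \<open>U\<close> can be
  replaced by \<open>(U \<inter> W) + P\<close>. Dimensions are compared by counting vectors over the finite field.\<close>

section \<open>Counting vectors\<close>

text \<open>A finite basis \<open>A\<close> identifies vectors with coordinate functions on
  \<open>A\<close>. Restricting to extensional functions makes the coordinates unique, so the
  function space can be counted.\<close>

lemma (in vectorspace) card_carrier:
  assumes fin: "finite (carrier K)" and fd: fin_dim
  shows "finite (carrier V)" and "card (carrier V) = order K ^ dim"
proof -
  obtain A where A: "finite A" "basis A" using finite_basis_exists[OF fd] by auto
  then have AV: "A \<subseteq> carrier V" by (simp add: basis_def)
  have crit: "\<exists>!a. a \<in> A \<rightarrow>\<^sub>E carrier K \<and> lincomb a A = v" if "v \<in> carrier V" for v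
    using basis_criterion[OF A(1) AV] A(2) that by blast
  have "bij_betw (\<lambda>a. lincomb a A) (A \<rightarrow>\<^sub>E carrier K) (carrier V)"
    unfolding bij_betw_def
  proof
    show "inj_on (\<lambda>a. lincomb a A) (A \<rightarrow>\<^sub>E carrier K)"
    proof (rule inj_onI)
      fix a b assume ab: "a \<in> A \<rightarrow>\<^sub>E carrier K" "b \<in> A \<rightarrow>\<^sub>E carrier K" "lincomb a A = lincomb b A"
      then have "lincomb b A \<in> carrier V" using AV by (intro lincomb_closed) auto
      with crit ab show "a = b" by metis
    qed
    show "(\<lambda>a. lincomb a A) ` (A \<rightarrow>\<^sub>E carrier K) = carrier V"
    proof
      show "(\<lambda>a. lincomb a A) ` (A \<rightarrow>\<^sub>E carrier K) \<subseteq> carrier V"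
        using AV by auto
      show "carrier V \<subseteq> (\<lambda>a. lincomb a A) ` (A \<rightarrow>\<^sub>E carrier K)"
        using crit by blast
    qed
  qed
  moreover have "finite (A \<rightarrow>\<^sub>E carrier K)" using A(1) fin by (simp add: finite_PiE)
  ultimately show "finite (carrier V)" "card (carrier V) = order K ^ dim"
    using card_funcsetE[OF A(1), of "carrier K"] dim_basis[OF A]
    by (auto simp: order_def dest: bij_betw_finite bij_betw_same_card)
qed

text \<open>The whole carrier serves as a finite spanning set. Subspaces and quotients of a finite
  space thus become finite-dimensional without any choice of bases.\<close>

lemma (in vectorspace) finite_imp_fin_dim:
  assumes "finite (carrier V)"
  shows fin_dim
  unfolding fin_dim_def
  using assms in_own_span[of "carrier V"] span_is_subset2[of "carrier V"] by blast

lemma (in vectorspace) order_field_gt_1: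
  assumes "finite (carrier K)"
  shows "1 < order K"
proof -
  have "card {\<zero>\<^bsub>K\<^esub>, \<one>\<^bsub>K\<^esub>} \<le> card (carrier K)"
    using assms by (intro card_mono) auto
  then show ?thesis by (simp add: order_def)
qed

text \<open>Translates dimensions into cardinalities. Since \<open>order K\<close> exceeds 1,
  exponents can be read back from powers, so every later dimension formula reduces to a
  count.\<close>

lemma (in vectorspace) card_subspace:
  assumes "finite (carrier K)" and "finite (carrier V)" and "subspace K U V"
  shows "card U = order K ^ sdim K V U"
proof -
  interpret U: vectorspace K "vs U" using assms(3) by (rule subspace_is_vs)
  have "U \<subseteq> carrier V" using assms(3) by (simp add: subspace_def submodule_def)
  then have "finite (carrier (vs U))" using assms(2) by (auto intro: finite_subset)
  then show ?thesis
    using U.card_carrier[OF assms(1) U.finite_imp_fin_dim] by (simp add: sdim_def)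
qed

section \<open>Closure properties of subspaces\<close>

lemma (in vectorspace) subspaceI:
  assumes "U \<subseteq> carrier V" and "\<zero>\<^bsub>V\<^esub> \<in> U"
    and "\<And>x y. \<lbrakk>x \<in> U; y \<in> U\<rbrakk> \<Longrightarrow> x \<oplus>\<^bsub>V\<^esub> y \<in> U"
    and "\<And>a x. \<lbrakk>a \<in> carrier K; x \<in> U\<rbrakk> \<Longrightarrow> a \<odot>\<^bsub>V\<^esub> x \<in> U"
  shows "subspace K U V"
  using assms vectorspace_axioms module_axioms
  by (simp add: subspace_def submodule_def)

lemma (in vectorspace) subspace_uminus:
  assumes "subspace K U V" and "x \<in> U"
  shows "\<ominus>\<^bsub>V\<^esub> x \<in> U"
proof -
  interpret submodule K U V using assms(1) by (rule is_module)
  have "(\<ominus>\<^bsub>K\<^esub> \<one>\<^bsub>K\<^esub>) \<odot>\<^bsub>V\<^esub> x \<in> U" using assms(2) by simp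
  moreover have "(\<ominus>\<^bsub>K\<^esub> \<one>\<^bsub>K\<^esub>) \<odot>\<^bsub>V\<^esub> x = \<ominus>\<^bsub>V\<^esub> x"
    using assms(2) subset by (subst smult_l_minus) auto
  ultimately show ?thesis by simp
qed

lemma (in vectorspace) subspace_abelian_subgroup:
  assumes "subspace K U V"
  shows "abelian_subgroup U V"
proof -
  interpret submodule K U V using assms by (rule is_module)
  have "U \<noteq> {}" using submodule.zero_closed[OF is_module[OF assms]] by blast
  then have "subgroup U (add_monoid V)"
    using subset subspace_uminus[OF assms]
    by (intro add.subgroupI) auto
  then show ?thesis
    by (intro abelian_subgroupI3 additive_subgroup.intro) (auto intro: abelian_group_axioms)
qed

lemma (in vectorspace) subspace_of_subspace:
  assumes "subspace K W V"
  shows "subspace K U (vs W) \<longleftrightarrow> subspace K U V \<and> U \<subseteq> W"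
  using assms subspace_is_vs[OF assms] vectorspace_axioms module_axioms
  by (auto simp: subspace_def submodule_def vectorspace_def)

section \<open>Adjoining one vector to a subspace\<close>

lemma (in vectorspace) smult_mem_cancel:
  assumes "subspace K U V" "a \<in> carrier K" "x \<in> carrier V" "a \<odot>\<^bsub>V\<^esub> x \<in> U" "a \<noteq> \<zero>\<^bsub>K\<^esub>"
  shows "x \<in> U"
proof -
  have "inv\<^bsub>K\<^esub> a \<in> carrier K" using assms field_Units by auto
  then have "inv\<^bsub>K\<^esub> a \<odot>\<^bsub>V\<^esub> (a \<odot>\<^bsub>V\<^esub> x) \<in> U"
    using submodule.smult_closed[OF is_module[OF assms(1)]] assms(4) by blast
  then show ?thesis using mult_inverse[OF assms(2,3) refl assms(5)] by metis
qed

text \<open>This is the sum of \<open>U\<close> and the span of \<open>h\<close>, written as the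
  image of a product so that its size follows from injectivity of the parametrization. With
  \<open>U\<close> the zero space it is the point spanned by \<open>h\<close>.\<close>

definition (in vectorspace) adjoin :: "'c set \<Rightarrow> 'c \<Rightarrow> 'c set" where
  "adjoin U h = (\<lambda>(a, x). a \<odot>\<^bsub>V\<^esub> h \<oplus>\<^bsub>V\<^esub> x) ` (carrier K \<times> U)"

lemma (in vectorspace) adjoin_subspace:
  assumes "subspace K U V" "h \<in> carrier V"
  shows "subspace K (adjoin U h) V" and "U \<subseteq> adjoin U h" and "h \<in> adjoin U h"
proof -
  interpret submodule K U V using assms(1) by (rule is_module)
  have UV[simp]: "x \<in> carrier V" if "x \<in> U" for x using subset that by auto
  show *: "U \<subseteq> adjoin U h"
  proof
    fix x assume "x \<in> U"
    then show "x \<in> adjoin U h" unfolding adjoin_def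
      using assms(2) by (intro image_eqI[of _ _ "(\<zero>\<^bsub>K\<^esub>, x)"]) auto
  qed
  show "h \<in> adjoin U h" unfolding adjoin_def
    using assms(2) by (intro image_eqI[of _ _ "(\<one>\<^bsub>K\<^esub>, \<zero>\<^bsub>V\<^esub>)"]) auto
  show "subspace K (adjoin U h) V"
  proof (rule subspaceI)
    show "adjoin U h \<subseteq> carrier V" using assms(2) by (auto simp: adjoin_def)
    show "\<zero>\<^bsub>V\<^esub> \<in> adjoin U h" using * by auto
    fix y assume "y \<in> adjoin U h"
    then obtain a x where ax: "a \<in> carrier K" "x \<in> U" "y = a \<odot>\<^bsub>V\<^esub> h \<oplus>\<^bsub>V\<^esub> x"
      by (auto simp: adjoin_def)
    { fix z assume "z \<in> adjoin U h"
      then obtain b w where bw: "b \<in> carrier K" "w \<in> U" "z = b \<odot>\<^bsub>V\<^esub> h \<oplus>\<^bsub>V\<^esub> w"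
        by (auto simp: adjoin_def)
      have "y \<oplus>\<^bsub>V\<^esub> z = (a \<oplus>\<^bsub>K\<^esub> b) \<odot>\<^bsub>V\<^esub> h \<oplus>\<^bsub>V\<^esub> (x \<oplus>\<^bsub>V\<^esub> w)"
        using ax bw assms(2) by (simp add: smult_l_distr M.a_ac)
      then show "y \<oplus>\<^bsub>V\<^esub> z \<in> adjoin U h" using ax bw by (auto simp: adjoin_def) }
    fix b assume b: "b \<in> carrier K"
    have "b \<odot>\<^bsub>V\<^esub> y = (b \<otimes>\<^bsub>K\<^esub> a) \<odot>\<^bsub>V\<^esub> h \<oplus>\<^bsub>V\<^esub> b \<odot>\<^bsub>V\<^esub> x"
      using ax b assms(2) by (simp add: smult_r_distr smult_assoc1)
    then show "b \<odot>\<^bsub>V\<^esub> y \<in> adjoin U h" using ax b by (auto simp: adjoin_def)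
  qed
qed

text \<open>Two representations of the same vector put a multiple of \<open>h\<close> by the
  difference of the coefficients into \<open>U\<close>. As \<open>h\<close> is outside
  \<open>U\<close>, that difference is zero and the parametrization is injective.\<close>

lemma (in vectorspace) card_adjoin:
  assumes U: "subspace K U V" and h: "h \<in> carrier V" "h \<notin> U"
  shows "card (adjoin U h) = order K * card U"
proof -
  interpret submodule K U V using U by (rule is_module)
  have UV[simp]: "x \<in> carrier V" if "x \<in> U" for x using subset that by auto
  have "inj_on (\<lambda>(a, x). a \<odot>\<^bsub>V\<^esub> h \<oplus>\<^bsub>V\<^esub> x) (carrier K \<times> U)"
  proof (rule inj_onI, clarify)
    fix a x b y
    assume *: "a \<in> carrier K" "b \<in> carrier K" "x \<in> U" "y \<in> U"
      and eq: "a \<odot>\<^bsub>V\<^esub> h \<oplus>\<^bsub>V\<^esub> x = b \<odot>\<^bsub>V\<^esub> h \<oplus>\<^bsub>V\<^esub> y"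
    have "(a \<ominus>\<^bsub>K\<^esub> b) \<odot>\<^bsub>V\<^esub> h = a \<odot>\<^bsub>V\<^esub> h \<oplus>\<^bsub>V\<^esub> \<ominus>\<^bsub>V\<^esub> (b \<odot>\<^bsub>V\<^esub> h)"
      using * h by (simp add: a_minus_def smult_l_distr smult_l_minus)
    also have "\<dots> = (a \<odot>\<^bsub>V\<^esub> h \<oplus>\<^bsub>V\<^esub> x) \<oplus>\<^bsub>V\<^esub> \<ominus>\<^bsub>V\<^esub> x \<oplus>\<^bsub>V\<^esub> \<ominus>\<^bsub>V\<^esub> (b \<odot>\<^bsub>V\<^esub> h)"
      using * h by (simp add: M.a_assoc M.r_neg)
    also have "\<dots> = (b \<odot>\<^bsub>V\<^esub> h \<oplus>\<^bsub>V\<^esub> y) \<oplus>\<^bsub>V\<^esub> \<ominus>\<^bsub>V\<^esub> x \<oplus>\<^bsub>V\<^esub> \<ominus>\<^bsub>V\<^esub> (b \<odot>\<^bsub>V\<^esub> h)"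
      by (simp add: eq)
    also have "\<dots> = y \<oplus>\<^bsub>V\<^esub> \<ominus>\<^bsub>V\<^esub> x"
      using * h by (simp add: M.a_ac M.r_neg1 M.r_neg)
    finally have "(a \<ominus>\<^bsub>K\<^esub> b) \<odot>\<^bsub>V\<^esub> h \<in> U"
      using * subspace_uminus[OF U] by simp
    then have "a \<ominus>\<^bsub>K\<^esub> b = \<zero>\<^bsub>K\<^esub>"
      using smult_mem_cancel[OF U _ h(1)] h(2) * by blast
    then have "a = b" using * by simp
    moreover from this have "x = y" using eq * h by simp
    ultimately show "a = b \<and> x = y" by simp
  qed
  then show ?thesis
    by (simp add: adjoin_def card_image card_cartesian_product order_def)
qed

section \<open>Quotient spaces\<close>

text \<open>The carrier only selects the representatives, while the cosets themselves depend on
  addition alone. All quotients are handled below as images under one coset map.\<close>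

lemma quotient_set_eq: "quotient_set V U N = (\<lambda>x. N +>\<^bsub>V\<^esub> x) ` U"
  by (auto simp: quotient_set_def A_RCOSETS_def' a_r_coset_def')

locale quotient_vectorspace = vectorspace K V for K V +
  fixes N
  assumes subspace_N: "subspace K N V"
begin

sublocale N: abelian_subgroup N V
  by (rule subspace_abelian_subgroup[OF subspace_N])

sublocale N: submodule K N V
  by (rule is_module[OF subspace_N])

abbreviation coset ("\<langle>_\<rangle>") where "\<langle>x\<rangle> \<equiv> N +>\<^bsub>V\<^esub> x"

abbreviation Q where "Q \<equiv> quotient_space V N"

lemma mem_coset: "y \<in> \<langle>x\<rangle> \<longleftrightarrow> (\<exists>n\<in>N. y = n \<oplus>\<^bsub>V\<^esub> x)"
  by (auto simp: a_r_coset_def')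

lemma self_mem_coset: "x \<in> carrier V \<Longrightarrow> x \<in> \<langle>x\<rangle>"
  using N.zero_closed by (force simp: mem_coset)

lemma coset_eq_N_iff: "x \<in> carrier V \<Longrightarrow> \<langle>x\<rangle> = N \<longleftrightarrow> x \<in> N"
  using N.a_rcos_const self_mem_coset by metis

lemma carrier_Q: "carrier Q = coset ` carrier V"
  by (simp add: quotient_space_def quotient_set_eq)

lemma zero_Q: "\<zero>\<^bsub>Q\<^esub> = N"
  by (simp add: quotient_space_def)

lemma add_Q: "\<lbrakk>x \<in> carrier V; y \<in> carrier V\<rbrakk> \<Longrightarrow> \<langle>x\<rangle> \<oplus>\<^bsub>Q\<^esub> \<langle>y\<rangle> = \<langle>x \<oplus>\<^bsub>V\<^esub> y\<rangle>"
  by (simp add: quotient_space_def N.a_rcos_sum)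

text \<open>The multiples of \<open>N\<close> are absorbed by the summand \<open>N\<close> in the
  definition of the action. That summand matters for \<open>a = 0\<close>, where the elementwise
  image of a coset is only the zero vector.\<close>

lemma smult_Q:
  assumes "a \<in> carrier K" "x \<in> carrier V"
  shows "a \<odot>\<^bsub>Q\<^esub> \<langle>x\<rangle> = \<langle>a \<odot>\<^bsub>V\<^esub> x\<rangle>"
proof -
  have "N <+>\<^bsub>V\<^esub> (\<lambda>y. a \<odot>\<^bsub>V\<^esub> y) ` \<langle>x\<rangle> = \<langle>a \<odot>\<^bsub>V\<^esub> x\<rangle>"
  proof (intro equalityI subsetI)
    fix z assume "z \<in> N <+>\<^bsub>V\<^esub> (\<lambda>y. a \<odot>\<^bsub>V\<^esub> y) ` \<langle>x\<rangle>"
    then obtain n m where "n \<in> N" "m \<in> N" "z = n \<oplus>\<^bsub>V\<^esub> a \<odot>\<^bsub>V\<^esub> (m \<oplus>\<^bsub>V\<^esub> x)"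
      by (auto simp: set_add_def' mem_coset)
    moreover from this have "z = (n \<oplus>\<^bsub>V\<^esub> a \<odot>\<^bsub>V\<^esub> m) \<oplus>\<^bsub>V\<^esub> a \<odot>\<^bsub>V\<^esub> x"
      using assms N.subset by (simp add: smult_r_distr M.a_assoc subset_eq)
    ultimately show "z \<in> \<langle>a \<odot>\<^bsub>V\<^esub> x\<rangle>"
      using assms(1) mem_coset by blast
  next
    fix z assume "z \<in> \<langle>a \<odot>\<^bsub>V\<^esub> x\<rangle>"
    then show "z \<in> N <+>\<^bsub>V\<^esub> (\<lambda>y. a \<odot>\<^bsub>V\<^esub> y) ` \<langle>x\<rangle>"
      using self_mem_coset[OF assms(2)] by (auto simp: set_add_def' mem_coset[of z])
  qed
  then show ?thesis by (simp add: quotient_space_def)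
qed

lemma vectorspace_Q: "vectorspace K Q"
proof (rule vs_criteria)
  show "field K" ..
  have "\<langle>\<zero>\<^bsub>V\<^esub>\<rangle> = N" by (simp add: coset_eq_N_iff)
  then show "\<zero>\<^bsub>Q\<^esub> \<in> carrier Q" by (force simp: carrier_Q zero_Q)
  have zero: "\<zero>\<^bsub>Q\<^esub> = \<langle>\<zero>\<^bsub>V\<^esub>\<rangle>" using \<open>\<langle>\<zero>\<^bsub>V\<^esub>\<rangle> = N\<close> zero_Q by simp
  show "\<forall>v\<in>carrier Q. \<exists>neg_v\<in>carrier Q. v \<oplus>\<^bsub>Q\<^esub> neg_v = \<zero>\<^bsub>Q\<^esub>"
  proof
    fix v assume "v \<in> carrier Q"
    then obtain x where "x \<in> carrier V" "v = \<langle>x\<rangle>" by (auto simp: carrier_Q)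
    then show "\<exists>neg_v\<in>carrier Q. v \<oplus>\<^bsub>Q\<^esub> neg_v = \<zero>\<^bsub>Q\<^esub>"
      by (intro bexI[of _ "\<langle>\<ominus>\<^bsub>V\<^esub> x\<rangle>"]) (auto simp: carrier_Q zero add_Q M.r_neg)
  qed
  show "\<forall>v\<in>carrier Q. v \<oplus>\<^bsub>Q\<^esub> \<zero>\<^bsub>Q\<^esub> = v"
    by (auto simp: carrier_Q zero add_Q)
qed (auto simp: carrier_Q add_Q smult_Q M.a_ac smult_assoc1 smult_l_distr smult_r_distr)

section \<open>Correspondence between subspaces of the quotient and subspaces above
  \<open>N\<close>\<close>

lemma subspace_image:
  assumes "subspace K U V"
  shows "subspace K (coset ` U) Q"
proof -
  interpret Q: vectorspace K Q by (rule vectorspace_Q)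
  interpret U: submodule K U V by (rule is_module[OF assms])
  have U: "x \<in> carrier V" if "x \<in> U" for x using that U.subset by auto
  show ?thesis
  proof (rule Q.subspaceI)
    have "\<langle>\<zero>\<^bsub>V\<^esub>\<rangle> = N" by (simp add: coset_eq_N_iff)
    then show "\<zero>\<^bsub>Q\<^esub> \<in> coset ` U" using U.zero_closed by (force simp: zero_Q)
  qed (auto simp: carrier_Q add_Q smult_Q U)
qed

text \<open>Take the full preimage under the coset map. It contains \<open>N\<close> because
  \<open>N\<close> is the zero of the quotient.\<close>

lemma subspace_Q_obtains:
  assumes "subspace K S Q"
  obtains U where "subspace K U V" "N \<subseteq> U" "S = coset ` U"
proof
  interpret Q: vectorspace K Q by (rule vectorspace_Q)
  interpret S: submodule K S Q by (rule Q.is_module[OF assms])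
  define U where "U = {x \<in> carrier V. \<langle>x\<rangle> \<in> S}"
  show NU: "N \<subseteq> U"
    using N.subset S.zero_closed by (auto simp: U_def zero_Q N.a_rcos_const)
  show "subspace K U V"
  proof (rule subspaceI)
    show "\<zero>\<^bsub>V\<^esub> \<in> U" using NU by auto
  qed (auto simp: U_def add_Q[symmetric] smult_Q[symmetric])
  show "S = coset ` U" using S.subset by (auto simp: U_def carrier_Q)
qed

text \<open>A vector with the same coset as some \<open>u\<close> in \<open>U\<close> differs from
  \<open>u\<close> by an element of \<open>N\<close>, hence of \<open>U\<close>. So \<open>U\<close>
  can be recovered from its image, and inclusions are reflected.\<close>

lemma coset_mem_image_iff:
  assumes "subspace K U V" "N \<subseteq> U" "x \<in> carrier V"
  shows "\<langle>x\<rangle> \<in> coset ` U \<longleftrightarrow> x \<in> U"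
proof
  interpret U: submodule K U V by (rule is_module[OF assms(1)])
  assume "\<langle>x\<rangle> \<in> coset ` U"
  then obtain u where "u \<in> U" "x \<in> \<langle>u\<rangle>" using self_mem_coset[OF assms(3)] by auto
  then show "x \<in> U" using assms(2) by (auto simp: mem_coset)
qed auto

lemma image_subset_iff:
  assumes "subspace K U V" "N \<subseteq> U" "T \<subseteq> carrier V"
  shows "coset ` T \<subseteq> coset ` U \<longleftrightarrow> T \<subseteq> U"
  using coset_mem_image_iff[OF assms(1,2)] assms(3) by blast

text \<open>Lagrange's theorem for the additive group of \<open>U\<close> and its subgroup
  \<open>N\<close>.\<close>

lemma card_image:
  assumes "finite (carrier V)" "subspace K U V" "N \<subseteq> U"
  shows "card U = card (coset ` U) * card N"
proof -
  interpret U: vectorspace K "vs U" by (rule subspace_is_vs[OF assms(2)])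
  have "subspace K N (vs U)" using subspace_of_subspace[OF assms(2)] subspace_N assms(3) by simp
  then have "subgroup N (add_monoid (vs U))"
    using U.subspace_abelian_subgroup abelian_subgroup.axioms(1) additive_subgroup.a_subgroup by blast
  then have "card (rcosets\<^bsub>add_monoid (vs U)\<^esub> N) * card N = order (add_monoid (vs U))"
    by (rule U.add.lagrange)
  moreover have "rcosets\<^bsub>add_monoid (vs U)\<^esub> N = coset ` U"
    using quotient_set_eq[of V U N] by (simp add: quotient_set_def A_RCOSETS_def)
  ultimately show ?thesis by (simp add: order_def)
qed

end

section \<open>Pairings and singular vectors\<close>

text \<open>Together with the pairing this predicate covers all three kinds of forms. It holds for
  every vector if the form is alternating, and carries information beyond the pairing only in the
  quadratic case.\<close>

fun singular :: "('k, 'm) ring_scheme \<Rightarrow> ('k, 'v) form \<Rightarrow> 'v \<Rightarrow> bool" where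
  "singular K (Alternating B) v \<longleftrightarrow> B v v = \<zero>\<^bsub>K\<^esub>"
| "singular K (Hermitian B) v \<longleftrightarrow> B v v = \<zero>\<^bsub>K\<^esub>"
| "singular K (Quadratic f) v \<longleftrightarrow> f v = \<zero>\<^bsub>K\<^esub>"

locale formed_space = vectorspace K V for K V +
  fixes F
  assumes wf: "wf_form K V F"
begin

abbreviation b where "b \<equiv> pairing K V F"

text \<open>The map \<open>\<sigma>\<close> is the identity except in the Hermitian case. Hiding it
  behind an existential lets the rules below cover all forms at once.\<close>

lemma pairing_sesquilinear:
  obtains \<sigma> where "sesquilinear_form K V \<sigma> b"
proof (cases F)
  case (Alternating B)
  then have "sesquilinear_form K V (\<lambda>a. a) b" using wf by (simp add: alternating_form_def)
  then show ?thesis by (rule that)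
next
  case (Hermitian B)
  then obtain \<sigma> where "sesquilinear_form K V \<sigma> b"
    using wf unfolding Hermitian wf_form.simps hermitian_form_def pairing.simps by blast
  then show ?thesis by (rule that)
next
  case (Quadratic f)
  then have "sesquilinear_form K V (\<lambda>a. a) b" using wf by (simp add: quadratic_form_def)
  then show ?thesis by (rule that)
qed

lemma pairing_closed [simp]: "\<lbrakk>u \<in> carrier V; v \<in> carrier V\<rbrakk> \<Longrightarrow> b u v \<in> carrier K"
  and pairing_add_left:
    "\<lbrakk>u \<in> carrier V; v \<in> carrier V; w \<in> carrier V\<rbrakk> \<Longrightarrow> b (u \<oplus>\<^bsub>V\<^esub> v) w = b u w \<oplus>\<^bsub>K\<^esub> b v w"
  and pairing_add_right:
    "\<lbrakk>u \<in> carrier V; v \<in> carrier V; w \<in> carrier V\<rbrakk> \<Longrightarrow> b u (v \<oplus>\<^bsub>V\<^esub> w) = b u v \<oplus>\<^bsub>K\<^esub> b u w"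
  and pairing_smult_left:
    "\<lbrakk>a \<in> carrier K; u \<in> carrier V; v \<in> carrier V\<rbrakk> \<Longrightarrow> b (a \<odot>\<^bsub>V\<^esub> u) v = a \<otimes>\<^bsub>K\<^esub> b u v"
proof -
  obtain \<sigma> where "sesquilinear_form K V \<sigma> b" using pairing_sesquilinear by blast
  note s = this[unfolded sesquilinear_form_def]
  show "\<lbrakk>u \<in> carrier V; v \<in> carrier V\<rbrakk> \<Longrightarrow> b u v \<in> carrier K"
    and "\<lbrakk>u \<in> carrier V; v \<in> carrier V; w \<in> carrier V\<rbrakk> \<Longrightarrow> b (u \<oplus>\<^bsub>V\<^esub> v) w = b u w \<oplus>\<^bsub>K\<^esub> b v w"
    and "\<lbrakk>u \<in> carrier V; v \<in> carrier V; w \<in> carrier V\<rbrakk> \<Longrightarrow> b u (v \<oplus>\<^bsub>V\<^esub> w) = b u v \<oplus>\<^bsub>K\<^esub> b u w"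
    and "\<lbrakk>a \<in> carrier K; u \<in> carrier V; v \<in> carrier V\<rbrakk> \<Longrightarrow> b (a \<odot>\<^bsub>V\<^esub> u) v = a \<otimes>\<^bsub>K\<^esub> b u v"
    using s by simp_all
qed

lemma pairing_zero_left [simp]: "v \<in> carrier V \<Longrightarrow> b \<zero>\<^bsub>V\<^esub> v = \<zero>\<^bsub>K\<^esub>"
  using pairing_smult_left[of "\<zero>\<^bsub>K\<^esub>" "\<zero>\<^bsub>V\<^esub>" v] by simp

text \<open>For alternating forms, expand the vanishing value at \<open>(u + v, u + v)\<close>; for
  Hermitian forms, \<open>\<sigma>\<close> fixes zero; a polarization is symmetric.\<close>

lemma pairing_reflexive:
  assumes uv: "u \<in> carrier V" "v \<in> carrier V" "b u v = \<zero>\<^bsub>K\<^esub>"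
  shows "b v u = \<zero>\<^bsub>K\<^esub>"
proof (cases F)
  case (Alternating B)
  then have alt: "b w w = \<zero>\<^bsub>K\<^esub>" if "w \<in> carrier V" for w
    using wf that by (simp add: alternating_form_def)
  have "\<zero>\<^bsub>K\<^esub> = b (u \<oplus>\<^bsub>V\<^esub> v) (u \<oplus>\<^bsub>V\<^esub> v)" using uv alt by simp
  also have "\<dots> = b v u"
    using uv alt[OF uv(1)] alt[OF uv(2)] by (simp add: pairing_add_left pairing_add_right)
  finally show ?thesis by simp
next
  case (Hermitian B)
  then obtain \<sigma> where "\<sigma> \<in> ring_iso K K" "b v u = \<sigma> (b u v)"
    using wf uv(1,2) unfolding Hermitian wf_form.simps hermitian_form_def pairing.simps by blast
  then show ?thesis
    using uv(3) by (simp add: ring_iso_def ring_hom_zero[OF _ R.ring_axioms R.ring_axioms])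
next
  case (Quadratic f)
  then have f: "f w \<in> carrier K" if "w \<in> carrier V" for w
    using wf that by (simp add: quadratic_form_def)
  have "b v u = b u v"
    using uv(1,2) f by (simp add: Quadratic polarization_def a_minus_def R.a_ac M.a_comm)
  then show ?thesis using uv by simp
qed

lemma pairing_zero_right [simp]: "v \<in> carrier V \<Longrightarrow> b v \<zero>\<^bsub>V\<^esub> = \<zero>\<^bsub>K\<^esub>"
  by (rule pairing_reflexive) simp_all

text \<open>Homogeneity on the right would involve \<open>\<sigma>\<close>. For the value zero,
  reflexivity applied twice reduces the claim to homogeneity on the left.\<close>

lemma pairing_smult_right_zero:
  "\<lbrakk>a \<in> carrier K; u \<in> carrier V; v \<in> carrier V; b u v = \<zero>\<^bsub>K\<^esub>\<rbrakk> \<Longrightarrow> b u (a \<odot>\<^bsub>V\<^esub> v) = \<zero>\<^bsub>K\<^esub>"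
  using pairing_reflexive[of u v] pairing_smult_left[of a v u] pairing_reflexive[of "a \<odot>\<^bsub>V\<^esub> v" u]
  by simp

lemma quadratic_add:
  assumes "F = Quadratic f" "u \<in> carrier V" "v \<in> carrier V"
  shows "f (u \<oplus>\<^bsub>V\<^esub> v) = f u \<oplus>\<^bsub>K\<^esub> f v \<oplus>\<^bsub>K\<^esub> b u v"
proof -
  have f: "f w \<in> carrier K" if "w \<in> carrier V" for w
    using wf that assms(1) by (simp add: quadratic_form_def)
  have "x \<oplus>\<^bsub>K\<^esub> y \<oplus>\<^bsub>K\<^esub> (z \<ominus>\<^bsub>K\<^esub> x \<ominus>\<^bsub>K\<^esub> y) = z"
    if "x \<in> carrier K" "y \<in> carrier K" "z \<in> carrier K" for x y z
  proof -
    have "z \<ominus>\<^bsub>K\<^esub> x \<ominus>\<^bsub>K\<^esub> y = \<ominus>\<^bsub>K\<^esub> (x \<oplus>\<^bsub>K\<^esub> y) \<oplus>\<^bsub>K\<^esub> z"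
      using that by (simp add: a_minus_def R.minus_add R.a_ac)
    then show ?thesis using that by (simp add: R.r_neg2)
  qed
  then show ?thesis
    using assms f by (simp add: polarization_def)
qed

section \<open>Singular vectors\<close>

lemma singular_smult:
  assumes "a \<in> carrier K" "v \<in> carrier V" "singular K F v"
  shows "singular K F (a \<odot>\<^bsub>V\<^esub> v)"
proof (cases F)
  case (Quadratic f)
  then show ?thesis using assms wf by (simp add: quadratic_form_def)
next
  case (Alternating B)
  then show ?thesis using assms pairing_smult_left[of a v "a \<odot>\<^bsub>V\<^esub> v"] pairing_smult_right_zero[of a v v] by simp
next
  case (Hermitian B)
  then show ?thesis using assms pairing_smult_left[of a v "a \<odot>\<^bsub>V\<^esub> v"] pairing_smult_right_zero[of a v v] by simp
qed

lemma singular_zero: "singular K F \<zero>\<^bsub>V\<^esub>"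
proof (cases F)
  case (Quadratic f)
  then have q: "f (a \<odot>\<^bsub>V\<^esub> v) = a [^]\<^bsub>K\<^esub> (2::nat) \<otimes>\<^bsub>K\<^esub> f v"
    and f: "f v \<in> carrier K" if "a \<in> carrier K" "v \<in> carrier V" for a v
    using wf that by (simp_all add: quadratic_form_def)
  have "f \<zero>\<^bsub>V\<^esub> = \<zero>\<^bsub>K\<^esub>"
    using q[of "\<zero>\<^bsub>K\<^esub>" "\<zero>\<^bsub>V\<^esub>"] f[of "\<zero>\<^bsub>K\<^esub>" "\<zero>\<^bsub>V\<^esub>"] by (simp add: R.nat_pow_zero)
  then show ?thesis using Quadratic by simp
next
  case (Alternating B)
  then show ?thesis using pairing_zero_left[of "\<zero>\<^bsub>V\<^esub>"] by simp
next
  case (Hermitian B)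
  then show ?thesis using pairing_zero_left[of "\<zero>\<^bsub>V\<^esub>"] by simp
qed

lemma singular_pairing_self:
  assumes "v \<in> carrier V" "singular K F v"
  shows "b v v = \<zero>\<^bsub>K\<^esub>"
proof (cases F)
  case (Quadratic f)
  \<comment> \<open>As a scalar multiple of \<open>v\<close>, the vector \<open>v + v\<close> is
    singular, so all terms of the polarization at \<open>(v, v)\<close> vanish. This works in every
    characteristic.\<close>
  have "(\<one>\<^bsub>K\<^esub> \<oplus>\<^bsub>K\<^esub> \<one>\<^bsub>K\<^esub>) \<odot>\<^bsub>V\<^esub> v = v \<oplus>\<^bsub>V\<^esub> v"
    using assms(1) by (simp add: smult_l_distr)
  moreover have "singular K F ((\<one>\<^bsub>K\<^esub> \<oplus>\<^bsub>K\<^esub> \<one>\<^bsub>K\<^esub>) \<odot>\<^bsub>V\<^esub> v)"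
    using R.one_closed R.add.m_closed by (intro singular_smult assms) blast
  ultimately have "singular K F (v \<oplus>\<^bsub>V\<^esub> v)" by (rule subst)
  then have "f (v \<oplus>\<^bsub>V\<^esub> v) = \<zero>\<^bsub>K\<^esub>" "f v = \<zero>\<^bsub>K\<^esub>"
    using Quadratic assms(2) by simp_all
  then show ?thesis
    unfolding Quadratic pairing.simps polarization_def by (simp add: a_minus_def)
next
  case (Alternating B)
  then show ?thesis using assms(2) by simp
next
  case (Hermitian B)
  then show ?thesis using assms(2) by simp
qed

text \<open>The added vector is orthogonal to itself and to \<open>u\<close>, so neither the
  quadratic form nor the value \<open>b u u\<close> changes. This makes singularity well defined on
  the cosets of a singular point inside its perp.\<close>

lemma singular_add_iff:
  assumes uv: "u \<in> carrier V" "v \<in> carrier V" and "singular K F v" "b u v = \<zero>\<^bsub>K\<^esub>"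
  shows "singular K F (u \<oplus>\<^bsub>V\<^esub> v) \<longleftrightarrow> singular K F u"
proof -
  have "b v u = \<zero>\<^bsub>K\<^esub>" "b v v = \<zero>\<^bsub>K\<^esub>"
    using assms by (auto intro: pairing_reflexive singular_pairing_self)
  then have eq: "b (u \<oplus>\<^bsub>V\<^esub> v) (u \<oplus>\<^bsub>V\<^esub> v) = b u u"
    using uv \<open>b u v = \<zero>\<^bsub>K\<^esub>\<close> by (simp add: pairing_add_left pairing_add_right)
  show ?thesis
  proof (cases F)
    case (Quadratic f)
    have "f u \<in> carrier K"
      using wf uv(1) by (simp add: Quadratic quadratic_form_def)
    moreover have "f v = \<zero>\<^bsub>K\<^esub>" using assms(3) by (simp add: Quadratic)
    ultimately have "f (u \<oplus>\<^bsub>V\<^esub> v) = f u"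
      using quadratic_add[OF Quadratic uv] assms(4) by simp
    then show ?thesis by (simp add: Quadratic)
  next
    case (Alternating B)
    then show ?thesis using eq by simp
  next
    case (Hermitian B)
    then show ?thesis using eq by simp
  qed
qed

text \<open>In the quadratic case orthogonality comes for free: \<open>f\<close> vanishes at
  \<open>u\<close>, \<open>v\<close> and their sum, which lies in the subspace. In the other cases
  singularity is orthogonality of a vector to itself.\<close>

lemma totally_isotropic_iff:
  assumes "subspace K U V"
  shows "totally_isotropic K F U \<longleftrightarrow> (\<forall>u\<in>U. singular K F u) \<and> (\<forall>u\<in>U. \<forall>v\<in>U. b u v = \<zero>\<^bsub>K\<^esub>)"
proof (cases F)
  case (Quadratic f)
  have "b u v = \<zero>\<^bsub>K\<^esub>" if "\<forall>u\<in>U. f u = \<zero>\<^bsub>K\<^esub>" "u \<in> U" "v \<in> U" for u v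
    using that submodule.m_closed[OF is_module[OF assms] that(2,3)]
    by (simp add: Quadratic polarization_def a_minus_def)
  then show ?thesis unfolding Quadratic totally_isotropic.simps singular.simps by blast
next
  case (Alternating B)
  then show ?thesis unfolding Alternating totally_isotropic.simps singular.simps pairing.simps by blast
next
  case (Hermitian B)
  then show ?thesis unfolding Hermitian totally_isotropic.simps singular.simps pairing.simps by blast
qed

text \<open>For alternating and Hermitian forms a vector of the radical is orthogonal to itself, so
  asking for singularity does not shrink the radical.\<close>

lemma nondegenerate_iff:
  "nondegenerate K V F \<longleftrightarrow> {v \<in> perp K V F (carrier V). singular K F v} = {\<zero>\<^bsub>V\<^esub>}"
proof (cases F)
  case (Alternating B)
  then have "{v \<in> perp K V F (carrier V). singular K F v} = perp K V F (carrier V)"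
    by (auto simp: perp_def)
  then show ?thesis using Alternating by simp
next
  case (Hermitian B)
  then have "{v \<in> perp K V F (carrier V). singular K F v} = perp K V F (carrier V)"
    by (auto simp: perp_def)
  then show ?thesis using Hermitian by simp
qed simp

lemma polar_subspaces_eq:
  "polar_subspaces K V F = {U. subspace K U V \<and> (\<forall>u\<in>U. singular K F u) \<and>
     (\<forall>u\<in>U. \<forall>v\<in>U. b u v = \<zero>\<^bsub>K\<^esub>)}"
  using totally_isotropic_iff by (auto simp: polar_subspaces_def)

end

section \<open>The residue at a point\<close>

lemma a_r_coset_carrier_update [simp]: "a_r_coset (V\<lparr>carrier := W\<rparr>) = a_r_coset V"
  by (intro ext) (simp add: a_r_coset_def')

text \<open>The point is presented by a generator \<open>p\<close>, which turns orthogonality to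
  \<open>P\<close> into a single equation.\<close>

locale polar_point = formed_space K V F for K V F +
  fixes p P
  assumes finite_field: "finite (carrier K)" and fin_dim: fin_dim
    and nondegenerate: "nondegenerate K V F"
    and p: "p \<in> carrier V" "p \<noteq> \<zero>\<^bsub>V\<^esub>" "singular K F p"
    and P_eq: "P = adjoin {\<zero>\<^bsub>V\<^esub>} p"
begin

abbreviation W where "W \<equiv> perp K V F P"
abbreviation R where "R \<equiv> residue_space K V F P"
abbreviation F' where "F' \<equiv> induced_form F"
abbreviation coset ("\<langle>_\<rangle>") where "\<langle>x\<rangle> \<equiv> P +>\<^bsub>V\<^esub> x"

lemma finite_V: "finite (carrier V)"
  using card_carrier finite_field fin_dim by blast

lemma subspace_zero: "subspace K {\<zero>\<^bsub>V\<^esub>} V"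
  by (rule subspaceI) auto

lemma subspace_P: "subspace K P V" and p_in_P: "p \<in> P"
  using adjoin_subspace[OF subspace_zero p(1)] by (simp_all add: P_eq)

lemma card_P: "card P = order K"
  using card_adjoin[OF subspace_zero p(1)] p(2) by (simp add: P_eq)

lemma mem_P: "x \<in> P \<longleftrightarrow> (\<exists>a\<in>carrier K. x = a \<odot>\<^bsub>V\<^esub> p)"
  using p(1) by (auto simp: P_eq adjoin_def image_iff)

lemma singular_P: "x \<in> P \<Longrightarrow> singular K F x"
  using singular_smult[OF _ p(1,3)] by (auto simp: mem_P)

text \<open>Testing against the generator suffices, and reflexivity moves \<open>p\<close> to the
  right. Thus \<open>W\<close> is the kernel of a functional that is linear even in the Hermitian
  case.\<close>

lemma mem_W: "v \<in> W \<longleftrightarrow> v \<in> carrier V \<and> b v p = \<zero>\<^bsub>K\<^esub>"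
proof -
  have "b p v = \<zero>\<^bsub>K\<^esub> \<longleftrightarrow> b v p = \<zero>\<^bsub>K\<^esub>" if "v \<in> carrier V"
    using pairing_reflexive[OF that p(1)] pairing_reflexive[OF p(1) that] by blast
  moreover have "(\<forall>u\<in>P. b u v = \<zero>\<^bsub>K\<^esub>) \<longleftrightarrow> b p v = \<zero>\<^bsub>K\<^esub>" if "v \<in> carrier V"
    using p_in_P p(1) that by (auto simp: mem_P pairing_smult_left)
  ultimately show ?thesis by (auto simp: perp_def)
qed

lemma W_carrier: "x \<in> W \<Longrightarrow> x \<in> carrier V"
  by (simp add: mem_W)

lemma pairing_P_W: "\<lbrakk>n \<in> P; x \<in> W\<rbrakk> \<Longrightarrow> b n x = \<zero>\<^bsub>K\<^esub>"
  by (simp add: perp_def)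

lemma P_subset_W: "P \<subseteq> W"
  using p singular_pairing_self[OF p(1,3)] by (auto simp: mem_P mem_W pairing_smult_left)

lemma subspace_W: "subspace K W V"
  by (rule subspaceI) (auto simp: mem_W p pairing_add_left pairing_smult_left)

lemma subspace_Int_W:
  assumes "subspace K U V"
  shows "subspace K (U \<inter> W) V"
proof -
  interpret U: submodule K U V by (rule is_module[OF assms])
  interpret W: submodule K W V by (rule is_module[OF subspace_W])
  show ?thesis using U.subset by (intro subspaceI) auto
qed

text \<open>The kernel of the functional \<open>b _ p\<close> on \<open>U\<close> is
  \<open>U \<inter> W\<close>; one vector outside the kernel spans the rest of
  \<open>U\<close>.\<close>

lemma eq_adjoin_Int_W:
  assumes U: "subspace K U V" and h: "h \<in> U" "b h p \<noteq> \<zero>\<^bsub>K\<^esub>"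
  shows "U = adjoin (U \<inter> W) h"
proof
  interpret U: submodule K U V by (rule is_module[OF U])
  have hV: "h \<in> carrier V" using h(1) U.subset by auto
  show "adjoin (U \<inter> W) h \<subseteq> U" using h(1) by (auto simp: adjoin_def)
  show "U \<subseteq> adjoin (U \<inter> W) h"
  proof
    fix x assume x: "x \<in> U"
    then have xV: "x \<in> carrier V" using U.subset by auto
    have unit: "b h p \<in> Units K" using h(2) hV p(1) by (simp add: field_Units)
    \<comment> \<open>The coefficient is the one for which subtracting \<open>a\<close> times
      \<open>h\<close> from \<open>x\<close> lands in the kernel.\<close>
    define a where "a = b x p \<otimes>\<^bsub>K\<^esub> inv\<^bsub>K\<^esub> (b h p)"
    have a: "a \<in> carrier K" using unit xV p(1) by (simp add: a_def)
    define y where "y = x \<oplus>\<^bsub>V\<^esub> (\<ominus>\<^bsub>K\<^esub> a) \<odot>\<^bsub>V\<^esub> h"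
    have "a \<otimes>\<^bsub>K\<^esub> b h p = b x p"
      using unit xV hV p(1) by (simp add: a_def R.m_assoc)
    then have "b y p = \<zero>\<^bsub>K\<^esub>"
      using xV hV p(1) a by (simp add: y_def pairing_add_left pairing_smult_left R.l_minus R.r_neg)
    moreover have "y \<in> U" using x h(1) a by (simp add: y_def)
    moreover have "y \<in> carrier V" using a xV hV by (simp add: y_def)
    ultimately have "y \<in> U \<inter> W" by (simp add: mem_W)
    moreover have "x = a \<odot>\<^bsub>V\<^esub> h \<oplus>\<^bsub>V\<^esub> y"
      using a xV hV by (simp add: y_def smult_l_minus M.a_ac M.r_neg M.r_neg2)
    ultimately show "x \<in> adjoin (U \<inter> W) h" using a by (auto simp: adjoin_def)
  qed
qed

text \<open>Otherwise \<open>p\<close> would be a nonzero singular vector of the radical.\<close>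

lemma ex_not_perp: obtains h where "h \<in> carrier V" "b h p \<noteq> \<zero>\<^bsub>K\<^esub>"
proof (rule ccontr)
  assume "\<not> thesis"
  then have "p \<in> perp K V F (carrier V)" using that p(1) by (auto simp: perp_def)
  then show False using nondegenerate p by (auto simp: nondegenerate_iff)
qed

lemma subspace_carrier: "subspace K (carrier V) V"
  by (rule subspaceI) auto

text \<open>A vector of \<open>W\<close> orthogonal to \<open>W\<close> can be moved along \<open>p\<close>
  until it is orthogonal to a vector outside \<open>W\<close>, hence to all of \<open>V\<close>.\<close>

lemma radical_W:
  assumes x: "x \<in> W" "singular K F x" and perp: "\<And>y. y \<in> W \<Longrightarrow> b y x = \<zero>\<^bsub>K\<^esub>"
  shows "x \<in> P"
proof -
  interpret W: submodule K W V by (rule is_module[OF subspace_W])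
  obtain h where h: "h \<in> carrier V" "b h p \<noteq> \<zero>\<^bsub>K\<^esub>" by (rule ex_not_perp)
  have xV: "x \<in> carrier V" using x(1) by (rule W_carrier)
  have ph: "b p h \<noteq> \<zero>\<^bsub>K\<^esub>" using pairing_reflexive[OF p(1) h(1)] h(2) by blast
  then have unit: "b p h \<in> Units K" using h p(1) by (simp add: field_Units)
  define a where "a = b x h \<otimes>\<^bsub>K\<^esub> inv\<^bsub>K\<^esub> (b p h)"
  have a: "a \<in> carrier K" using unit xV h(1) by (simp add: a_def)
  have ap: "\<ominus>\<^bsub>K\<^esub> a \<odot>\<^bsub>V\<^esub> p \<in> P" using a by (auto simp: mem_P)
  define z where "z = x \<oplus>\<^bsub>V\<^esub> (\<ominus>\<^bsub>K\<^esub> a) \<odot>\<^bsub>V\<^esub> p"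
  have zV: "z \<in> carrier V" using a xV p(1) by (simp add: z_def)
  have "a \<otimes>\<^bsub>K\<^esub> b p h = b x h"
    using unit xV h(1) p(1) by (simp add: a_def R.m_assoc)
  then have "b z h = \<zero>\<^bsub>K\<^esub>"
    using xV h(1) p(1) a by (simp add: z_def pairing_add_left pairing_smult_left R.l_minus R.r_neg)
  then have hz: "b h z = \<zero>\<^bsub>K\<^esub>" using pairing_reflexive zV h(1) by blast
  have wz: "b w z = \<zero>\<^bsub>K\<^esub>" if "w \<in> W" for w
  proof -
    have "b w ((\<ominus>\<^bsub>K\<^esub> a) \<odot>\<^bsub>V\<^esub> p) = \<zero>\<^bsub>K\<^esub>"
      using that a p(1) by (intro pairing_smult_right_zero) (simp_all add: mem_W)
    then show ?thesis
      using perp[OF that] W_carrier[OF that] a xV p(1) by (simp add: z_def pairing_add_right)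
  qed
  have "b v z = \<zero>\<^bsub>K\<^esub>" if "v \<in> carrier V" for v
  proof -
    have "carrier V \<inter> W = W" using W_carrier by auto
    then have "v \<in> adjoin W h" using eq_adjoin_Int_W[OF subspace_carrier h] that by simp
    then obtain c w where "c \<in> carrier K" "w \<in> W" "v = c \<odot>\<^bsub>V\<^esub> h \<oplus>\<^bsub>V\<^esub> w"
      by (auto simp: adjoin_def)
    then show ?thesis
      using h(1) zV W_carrier by (simp add: pairing_add_left pairing_smult_left hz wz)
  qed
  \<comment> \<open>The correction is a singular multiple of \<open>p\<close> orthogonal to
    \<open>x\<close>, because \<open>x\<close> lies in \<open>W\<close>; it therefore preserves
    singularity.\<close>
  moreover have "singular K F z"
  proof -
    have "b x (\<ominus>\<^bsub>K\<^esub> a \<odot>\<^bsub>V\<^esub> p) = \<zero>\<^bsub>K\<^esub>"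
      using x(1) a p(1) by (intro pairing_smult_right_zero) (simp_all add: mem_W)
    then show ?thesis
      using singular_add_iff[of x "\<ominus>\<^bsub>K\<^esub> a \<odot>\<^bsub>V\<^esub> p"] singular_P[OF ap] x(2) xV a p(1) by (simp add: z_def)
  qed
  ultimately have "z = \<zero>\<^bsub>V\<^esub>"
    using nondegenerate zV by (auto simp: nondegenerate_iff perp_def)
  moreover have "x = z \<oplus>\<^bsub>V\<^esub> a \<odot>\<^bsub>V\<^esub> p"
    using a xV p(1) by (simp add: z_def smult_l_minus M.a_assoc M.l_neg)
  ultimately have "x = a \<odot>\<^bsub>V\<^esub> p" using a p(1) by simp
  then show ?thesis using a by (auto simp: mem_P)
qed

text \<open>The quotient theory is applied with \<open>W\<close> as ambient space. The rewrites
  restate its facts with the operations of \<open>V\<close> and with \<open>R\<close> as the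
  quotient.\<close>

interpretation res: quotient_vectorspace K "vs W" P
  rewrites "carrier (vs W) = W" and "add (vs W) = add V" and "zero (vs W) = zero V"
    and "smult (vs W) = smult V" and "a_r_coset (vs W) = a_r_coset V"
    and "quotient_space (vs W) P = R"
proof -
  have "subspace K P (vs W)"
    using subspace_P P_subset_W by (simp only: subspace_of_subspace[OF subspace_W])
  then show "quotient_vectorspace K (vs W) P"
    by (intro quotient_vectorspace.intro quotient_vectorspace_axioms.intro
        subspace_is_vs[OF subspace_W])
qed (simp_all add: residue_space_def)

text \<open>The interpretation ends with this context block; these names survive when the locale is
  reopened.\<close>

lemmas carrier_R = res.carrier_Q and zero_R = res.zero_Q and add_R = res.add_Q
  and smult_R = res.smult_Q and vectorspace_R = res.vectorspace_Q and mem_coset = res.mem_coset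
  and self_mem_coset = res.self_mem_coset and coset_eq_P_iff = res.coset_eq_N_iff

lemma subspace_image_R: "\<lbrakk>subspace K U V; U \<subseteq> W\<rbrakk> \<Longrightarrow> subspace K (coset ` U) R"
  by (rule res.subspace_image) (simp only: subspace_of_subspace[OF subspace_W])

lemma subspace_R_obtains:
  assumes "subspace K S R"
  obtains U where "subspace K U V" "P \<subseteq> U" "U \<subseteq> W" "S = coset ` U"
  using res.subspace_Q_obtains[OF assms] subspace_of_subspace[OF subspace_W] by metis

lemma image_subset_iff_R:
  assumes "subspace K U V" "P \<subseteq> U" "U \<subseteq> W" "T \<subseteq> W"
  shows "coset ` T \<subseteq> coset ` U \<longleftrightarrow> T \<subseteq> U"
  using res.image_subset_iff[of U T] assms subspace_of_subspace[OF subspace_W] by blast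

text \<open>By Lagrange, \<open>U\<close> has \<open>order K\<close> times as many elements as
  \<open>U/P\<close>; comparing exponents gives the shift by one.\<close>

lemma sdim_image:
  assumes U: "subspace K U V" "P \<subseteq> U" "U \<subseteq> W"
  shows "sdim K V U = Suc (sdim K R (coset ` U))"
proof -
  interpret Q: vectorspace K R by (rule vectorspace_R)
  have "finite W" using finite_V W_carrier by (auto intro: finite_subset)
  then have "card U = card (coset ` U) * card P"
    using res.card_image U subspace_of_subspace[OF subspace_W] by blast
  moreover have "finite (carrier R)" using \<open>finite W\<close> by (simp add: carrier_R)
  moreover have "subspace K (coset ` U) R" using U by (intro subspace_image_R)
  ultimately have "order K ^ sdim K V U = order K ^ Suc (sdim K R (coset ` U))"
    using card_subspace[OF finite_field finite_V U(1)] Q.card_subspace[OF finite_field] card_P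
    by (simp add: mult.commute)
  then show ?thesis using order_field_gt_1[OF finite_field] power_inject_exp by blast
qed

lemma sdim_adjoin:
  assumes "subspace K U V" "h \<in> carrier V" "h \<notin> U"
  shows "sdim K V (adjoin U h) = Suc (sdim K V U)"
proof -
  have "order K ^ sdim K V (adjoin U h) = order K ^ Suc (sdim K V U)"
    using card_adjoin[OF assms] card_subspace[OF finite_field finite_V assms(1)]
      card_subspace[OF finite_field finite_V adjoin_subspace(1)[OF assms(1,2)]] by simp
  then show ?thesis using order_field_gt_1[OF finite_field] power_inject_exp by blast
qed

text \<open>One dimension is lost from \<open>V\<close> to the hyperplane \<open>W\<close>, another
  from \<open>W\<close> to \<open>W/P\<close>.\<close>

lemma dim_R: "dim = vectorspace.dim K R + 2"
proof -
  obtain h where h: "h \<in> carrier V" "b h p \<noteq> \<zero>\<^bsub>K\<^esub>" by (rule ex_not_perp)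
  have "carrier V \<inter> W = W" using W_carrier by auto
  then have "carrier V = adjoin W h" using eq_adjoin_Int_W[OF subspace_carrier h] by simp
  then have "sdim K V (carrier V) = Suc (sdim K V W)"
    using sdim_adjoin[OF subspace_W h(1)] h(2) by (simp add: mem_W)
  also have "sdim K V W = Suc (sdim K R (carrier R))"
    using sdim_image[OF subspace_W P_subset_W] by (simp add: carrier_R)
  finally show ?thesis by (simp add: sdim_def)
qed

end

section \<open>The induced form\<close>

context polar_point
begin

text \<open>Representatives of a coset differ by elements of \<open>P\<close>, which are orthogonal
  to all of \<open>W\<close> and so also to \<open>P\<close> itself.\<close>

lemma pairing_const:
  assumes "x \<in> W" "y \<in> W" "u \<in> \<langle>x\<rangle>" "v \<in> \<langle>y\<rangle>"
  shows "b u v = b x y"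
proof -
  obtain m n where m: "m \<in> P" "u = m \<oplus>\<^bsub>V\<^esub> x" and n: "n \<in> P" "v = n \<oplus>\<^bsub>V\<^esub> y"
    using assms(3,4) by (auto simp: mem_coset)
  have W: "x \<in> carrier V" "y \<in> carrier V" "m \<in> carrier V" "n \<in> carrier V"
    using assms(1,2) m n P_subset_W W_carrier by auto
  have "b m y = \<zero>\<^bsub>K\<^esub>" "b m n = \<zero>\<^bsub>K\<^esub>" "b n x = \<zero>\<^bsub>K\<^esub>"
    using pairing_P_W m(1) n(1) assms(1,2) P_subset_W by auto
  moreover from this have "b x n = \<zero>\<^bsub>K\<^esub>" using pairing_reflexive W by blast
  ultimately show ?thesis using W by (simp add: m n pairing_add_left pairing_add_right)
qed

text \<open>The second part is finer than the first: the induced quadratic form needs the value of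
  \<open>f\<close>, not only its vanishing, to be constant on cosets.\<close>

lemma singular_coset:
  assumes "x \<in> W" "u \<in> \<langle>x\<rangle>"
  shows "singular K F u \<longleftrightarrow> singular K F x"
    and "F = Quadratic f \<Longrightarrow> f u = f x"
proof -
  obtain m where m: "m \<in> P" "u = m \<oplus>\<^bsub>V\<^esub> x" using assms(2) by (auto simp: mem_coset)
  have W: "x \<in> carrier V" "m \<in> carrier V" using assms(1) m P_subset_W W_carrier by auto
  have "b m x = \<zero>\<^bsub>K\<^esub>" using pairing_P_W m(1) assms(1) by auto
  then have bxm: "b x m = \<zero>\<^bsub>K\<^esub>" using pairing_reflexive W by blast
  have u: "u = x \<oplus>\<^bsub>V\<^esub> m" using m(2) W by (simp add: M.a_comm)
  show "singular K F u \<longleftrightarrow> singular K F x"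
    unfolding u using singular_add_iff[OF W singular_P[OF m(1)] bxm] .
  assume F: "F = Quadratic f"
  then have "f m = \<zero>\<^bsub>K\<^esub>" using singular_P[OF m(1)] by simp
  moreover have "f x \<in> carrier K" using wf W(1) by (simp add: F quadratic_form_def)
  ultimately show "f u = f x" unfolding u quadratic_add[OF F W] bxm by simp
qed

lemma the_elem_pairing:
  assumes "x \<in> W" "y \<in> W"
  shows "the_elem ((\<lambda>(x, y). b x y) ` (\<langle>x\<rangle> \<times> \<langle>y\<rangle>)) = b x y"
proof -
  let ?g = "\<lambda>(x, y). b x y"
  have "the_elem (?g ` (\<langle>x\<rangle> \<times> \<langle>y\<rangle>)) = ?g (x, y)"
  proof (rule the_elem_image_unique)
    show "\<langle>x\<rangle> \<times> \<langle>y\<rangle> \<noteq> {}" using self_mem_coset assms by blast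
    fix z assume "z \<in> \<langle>x\<rangle> \<times> \<langle>y\<rangle>"
    then obtain u v where "u \<in> \<langle>x\<rangle>" "v \<in> \<langle>y\<rangle>" "z = (u, v)" by (rule SigmaE)
    then show "?g z = ?g (x, y)" using pairing_const[OF assms] by (simp only: prod.case)
  qed
  then show ?thesis by (simp only: prod.case)
qed

lemma the_elem_quadratic:
  assumes "F = Quadratic f" "x \<in> W"
  shows "the_elem (f ` \<langle>x\<rangle>) = f x"
proof (rule the_elem_image_unique)
  show "\<langle>x\<rangle> \<noteq> {}" using self_mem_coset[OF assms(2)] by blast
  show "f u = f x" if "u \<in> \<langle>x\<rangle>" for u
    using singular_coset(2)[OF assms(2) that assms(1)] .
qed

text \<open>Together with \<open>singular_induced\<close> this carries facts between
  \<open>W\<close> and the quotient. In the quadratic case the polarization is evaluated at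
  \<open>x + y\<close>, which represents the sum of the cosets.\<close>

lemma pairing_induced:
  assumes "x \<in> W" "y \<in> W"
  shows "pairing K R F' \<langle>x\<rangle> \<langle>y\<rangle> = b x y"
proof (cases F)
  case (Quadratic f)
  have "x \<oplus>\<^bsub>V\<^esub> y \<in> W" using submodule.m_closed[OF is_module[OF subspace_W] assms] .
  then show ?thesis
    using assms the_elem_quadratic[OF Quadratic] add_R[OF assms]
    by (simp add: Quadratic polarization_def)
next
  case (Alternating B)
  then show ?thesis using the_elem_pairing[OF assms] by simp
next
  case (Hermitian B)
  then show ?thesis using the_elem_pairing[OF assms] by simp
qed

lemma singular_induced:
  assumes "x \<in> W"
  shows "singular K F' \<langle>x\<rangle> \<longleftrightarrow> singular K F x"
proof (cases F)
  case (Quadratic f)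
  then show ?thesis using the_elem_quadratic[OF Quadratic assms] by simp
next
  case (Alternating B)
  then show ?thesis using the_elem_pairing[OF assms assms] by simp
next
  case (Hermitian B)
  then show ?thesis using the_elem_pairing[OF assms assms] by simp
qed

lemma sesquilinear_induced:
  assumes "sesquilinear_form K V \<sigma> b"
  shows "sesquilinear_form K R \<sigma> (pairing K R F')"
proof -
  have closed: "x \<oplus>\<^bsub>V\<^esub> y \<in> W" "a \<odot>\<^bsub>V\<^esub> x \<in> W" if "x \<in> W" "y \<in> W" "a \<in> carrier K" for x y a
    using that submodule.m_closed[OF is_module[OF subspace_W]]
      submodule.smult_closed[OF is_module[OF subspace_W]] by auto
  have "pairing K R F' (\<langle>x\<rangle> \<oplus>\<^bsub>R\<^esub> \<langle>y\<rangle>) \<langle>z\<rangle> = pairing K R F' \<langle>x\<rangle> \<langle>z\<rangle> \<oplus>\<^bsub>K\<^esub> pairing K R F' \<langle>y\<rangle> \<langle>z\<rangle>"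
    "pairing K R F' \<langle>x\<rangle> (\<langle>y\<rangle> \<oplus>\<^bsub>R\<^esub> \<langle>z\<rangle>) = pairing K R F' \<langle>x\<rangle> \<langle>y\<rangle> \<oplus>\<^bsub>K\<^esub> pairing K R F' \<langle>x\<rangle> \<langle>z\<rangle>"
    if "x \<in> W" "y \<in> W" "z \<in> W" for x y z
    \<comment> \<open>The prefix in \<open>R.zero_closed\<close> refers to the ring
      \<open>K\<close>, not to the residue; the fact discharges the scalar premise of
      \<open>closed\<close>.\<close>
    using that closed[OF _ _ R.zero_closed] W_carrier
    by (simp_all add: add_R pairing_induced pairing_add_left pairing_add_right)
  moreover have "pairing K R F' (a \<odot>\<^bsub>R\<^esub> \<langle>x\<rangle>) \<langle>y\<rangle> = a \<otimes>\<^bsub>K\<^esub> pairing K R F' \<langle>x\<rangle> \<langle>y\<rangle>"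
    "pairing K R F' \<langle>x\<rangle> (a \<odot>\<^bsub>R\<^esub> \<langle>y\<rangle>) = \<sigma> a \<otimes>\<^bsub>K\<^esub> pairing K R F' \<langle>x\<rangle> \<langle>y\<rangle>"
    if "x \<in> W" "y \<in> W" "a \<in> carrier K" for x y a
    using that closed(2) W_carrier assms[unfolded sesquilinear_form_def]
    by (simp_all add: smult_R pairing_induced)
  moreover have "pairing K R F' \<langle>x\<rangle> \<langle>y\<rangle> \<in> carrier K" if "x \<in> W" "y \<in> W" for x y
    using that W_carrier by (simp add: pairing_induced)
  ultimately show ?thesis
    unfolding sesquilinear_form_def carrier_R ball_simps by (intro conjI ballI; blast)
qed

lemma wf_induced: "wf_form K R F'"
proof (cases F)
  case (Alternating B)
  then have ses: "sesquilinear_form K V (\<lambda>a. a) b"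
    and alt: "\<And>v. v \<in> carrier V \<Longrightarrow> b v v = \<zero>\<^bsub>K\<^esub>"
    using wf by (simp_all add: alternating_form_def)
  have "pairing K R F' v v = \<zero>\<^bsub>K\<^esub>" if "v \<in> carrier R" for v
  proof -
    obtain x where "x \<in> W" "v = \<langle>x\<rangle>" using \<open>v \<in> carrier R\<close> carrier_R by blast
    then show ?thesis using alt W_carrier pairing_induced by simp
  qed
  with sesquilinear_induced[OF ses] have "alternating_form K R (pairing K R F')"
    unfolding alternating_form_def by blast
  then show ?thesis by (simp add: Alternating)
next
  case (Hermitian B)
  then obtain \<sigma> where \<sigma>: "\<sigma> \<in> ring_iso K K" "\<forall>a\<in>carrier K. \<sigma> (\<sigma> a) = a" "\<exists>a\<in>carrier K. \<sigma> a \<noteq> a"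
    and ses: "sesquilinear_form K V \<sigma> b"
    and herm: "\<forall>u\<in>carrier V. \<forall>v\<in>carrier V. b v u = \<sigma> (b u v)"
    using wf unfolding Hermitian wf_form.simps hermitian_form_def pairing.simps by blast
  have "pairing K R F' v u = \<sigma> (pairing K R F' u v)" if uv: "u \<in> carrier R" "v \<in> carrier R" for u v
  proof -
    obtain x y where "x \<in> W" "y \<in> W" "u = \<langle>x\<rangle>" "v = \<langle>y\<rangle>" using uv by (auto simp: carrier_R)
    then show ?thesis using W_carrier herm by (metis pairing_induced)
  qed
  moreover note sesquilinear_induced[OF ses]
  ultimately have "hermitian_form K R (pairing K R F')"
    using \<sigma> unfolding hermitian_form_def by blast
  then show ?thesis by (simp add: Hermitian)
next
  case (Quadratic f)
  define f' where "f' X = the_elem (f ` X)" for X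
  have F': "F' = Quadratic f'" by (simp add: Quadratic f'_def fun_eq_iff)
  have f': "f' \<langle>x\<rangle> = f x" if "x \<in> W" for x
    using the_elem_quadratic[OF Quadratic that] by (simp add: f'_def)
  have q: "quadratic_form K V f" using wf by (simp add: Quadratic)
  have "sesquilinear_form K V (\<lambda>a. a) b" using q by (simp add: Quadratic quadratic_form_def)
  then have "bilinear_form K R (polarization K R f')"
    using sesquilinear_induced F' by (metis pairing.simps(3))
  moreover have "f' u \<in> carrier K" if "u \<in> carrier R" for u
    using that q W_carrier by (auto simp: carrier_R f' quadratic_form_def)
  moreover have "f' (a \<odot>\<^bsub>R\<^esub> u) = a [^]\<^bsub>K\<^esub> (2::nat) \<otimes>\<^bsub>K\<^esub> f' u"
    if au: "a \<in> carrier K" "u \<in> carrier R" for a u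
  proof -
    obtain x where x: "x \<in> W" "u = \<langle>x\<rangle>" using au by (auto simp: carrier_R)
    then have "a \<odot>\<^bsub>V\<^esub> x \<in> W"
      using submodule.smult_closed[OF is_module[OF subspace_W]] au(1) by blast
    then show ?thesis
      using x au(1) q W_carrier by (simp add: smult_R f' quadratic_form_def)
  qed
  ultimately show ?thesis by (simp add: F' quadratic_form_def)
qed

section \<open>Nondegeneracy and the subspaces of the residue\<close>

lemma formed_space_R: "formed_space K R F'"
  using vectorspace_R wf_induced by (simp add: formed_space_def formed_space_axioms_def)

text \<open>A singular coset in the radical has a singular representative orthogonal to all of
  \<open>W\<close>; by \<open>radical_W\<close> it lies in \<open>P\<close>, so the coset is
  zero.\<close>

lemma nondegenerate_induced: "Defs.nondegenerate K R F'"
proof -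
  interpret Q: formed_space K R F' by (rule formed_space_R)
  have "X = P" if X: "X \<in> perp K R F' (carrier R)" "singular K F' X" for X
  proof -
    have XR: "X \<in> carrier R" and perp: "\<And>Y. Y \<in> carrier R \<Longrightarrow> pairing K R F' Y X = \<zero>\<^bsub>K\<^esub>"
      using X(1) unfolding perp_def by blast+
    obtain x where x: "x \<in> W" "X = \<langle>x\<rangle>" using XR carrier_R by blast
    have "b y x = \<zero>\<^bsub>K\<^esub>" if "y \<in> W" for y
    proof -
      have "\<langle>y\<rangle> \<in> carrier R" using that carrier_R by blast
      then show ?thesis using perp pairing_induced[OF that x(1)] x(2) by simp
    qed
    moreover have "singular K F x" using X(2) x singular_induced by simp
    ultimately have "x \<in> P" using radical_W x(1) by blast
    then show "X = P" using coset_eq_P_iff x by simp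
  qed
  moreover have "\<zero>\<^bsub>R\<^esub> \<in> perp K R F' (carrier R)" "singular K F' \<zero>\<^bsub>R\<^esub>"
    using Q.singular_zero Q.pairing_zero_right by (simp_all add: perp_def)
  ultimately show ?thesis unfolding Q.nondegenerate_iff using zero_R by blast
qed

text \<open>Since \<open>U\<close> contains \<open>p\<close> and its vectors are pairwise
  orthogonal, it lies in \<open>W\<close>, where the form descends to cosets.\<close>

lemma polar_subspace_image:
  assumes "U \<in> polar_subspaces K V F" "P \<subseteq> U"
  shows "U \<subseteq> W" and "coset ` U \<in> polar_subspaces K R F'"
proof -
  interpret Q: formed_space K R F' by (rule formed_space_R)
  have U: "subspace K U V" "\<forall>u\<in>U. singular K F u" "\<forall>u\<in>U. \<forall>v\<in>U. b u v = \<zero>\<^bsub>K\<^esub>"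
    using assms(1) by (simp_all add: polar_subspaces_eq)
  have "U \<subseteq> carrier V" using submodule.subset[OF is_module[OF U(1)]] .
  moreover have "p \<in> U" using p_in_P assms(2) ..
  ultimately show UW: "U \<subseteq> W" using U(3) mem_W by blast
  have "singular K F' \<langle>u\<rangle>" if "u \<in> U" for u
    using that UW U(2) singular_induced by blast
  moreover have "pairing K R F' \<langle>u\<rangle> \<langle>v\<rangle> = \<zero>\<^bsub>K\<^esub>" if "u \<in> U" "v \<in> U" for u v
  proof -
    have "u \<in> W" "v \<in> W" using that UW by blast+
    then show ?thesis using that U(3) pairing_induced by simp
  qed
  ultimately show "coset ` U \<in> polar_subspaces K R F'"
    using subspace_image_R[OF U(1) UW] by (simp add: Q.polar_subspaces_eq)
qed

text \<open>The preimage subspace inherits singularity and orthogonality, because the induced values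
  are those of representatives.\<close>

lemma polar_subspace_obtains:
  assumes "S \<in> polar_subspaces K R F'"
  obtains U where "U \<in> polar_subspaces K V F" "P \<subseteq> U" "S = coset ` U"
proof -
  interpret Q: formed_space K R F' by (rule formed_space_R)
  have S: "subspace K S R" "\<forall>u\<in>S. singular K F' u" "\<forall>u\<in>S. \<forall>v\<in>S. pairing K R F' u v = \<zero>\<^bsub>K\<^esub>"
    using assms by (simp_all add: Q.polar_subspaces_eq)
  obtain U where U: "subspace K U V" "P \<subseteq> U" "U \<subseteq> W" "S = coset ` U"
    using subspace_R_obtains[OF S(1)] .
  have "singular K F u" if "u \<in> U" for u
    using that U(3,4) S(2) singular_induced by blast
  moreover have "b u v = \<zero>\<^bsub>K\<^esub>" if "u \<in> U" "v \<in> U" for u v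
  proof -
    have "u \<in> W" "v \<in> W" using that U(3) by blast+
    moreover have "pairing K R F' \<langle>u\<rangle> \<langle>v\<rangle> = \<zero>\<^bsub>K\<^esub>" using that S(3) U(4) by blast
    ultimately show ?thesis using pairing_induced by simp
  qed
  ultimately have "U \<in> polar_subspaces K V F" using U(1) by (simp add: polar_subspaces_eq)
  then show thesis using that U(2,4) by blast
qed

section \<open>Rank and type of the residue\<close>

lemma finite_polar_subspaces: "finite (polar_subspaces K V F)"
proof (rule finite_subset)
  show "polar_subspaces K V F \<subseteq> Pow (carrier V)"
    using submodule.subset[OF is_module] by (auto simp: polar_subspaces_def)
qed (simp add: finite_V)

lemma sdim_le_rank: "U \<in> polar_subspaces K V F \<Longrightarrow> sdim K V U \<le> polar_rank K V F"
  unfolding polar_rank_def using finite_polar_subspaces by (intro Max_ge) auto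

lemma max_polar_subspace_at_point:
  obtains U where "U \<in> polar_subspaces K V F" "P \<subseteq> U" "sdim K V U = polar_rank K V F"
proof -
  have "{\<zero>\<^bsub>V\<^esub>} \<in> polar_subspaces K V F"
    using subspace_zero singular_zero by (simp add: polar_subspaces_eq)
  then have "polar_rank K V F \<in> sdim K V ` polar_subspaces K V F"
    unfolding polar_rank_def using finite_polar_subspaces by (intro Max_in) auto
  then obtain U where U: "U \<in> polar_subspaces K V F" "sdim K V U = polar_rank K V F" by auto
  then have sub: "subspace K U V" and sing: "\<forall>u\<in>U. singular K F u"
    and orth: "\<forall>u\<in>U. \<forall>v\<in>U. b u v = \<zero>\<^bsub>K\<^esub>" by (simp_all add: polar_subspaces_eq)
  interpret U: submodule K U V by (rule is_module[OF sub])
  show thesis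
  proof (cases "p \<in> U")
    case True
    then have "P \<subseteq> U" by (auto simp: mem_P)
    then show thesis using that U by blast
  next
    case False
    let ?N = "U \<inter> W" and ?T = "adjoin (U \<inter> W) p"
    have N: "subspace K ?N V" by (rule subspace_Int_W[OF sub])
    have pN: "p \<notin> ?N" using False by simp
    have T: "subspace K ?T V" "?N \<subseteq> ?T" "p \<in> ?T" using adjoin_subspace[OF N p(1)] .
    \<comment> \<open>Intersecting with \<open>W\<close> loses at most one dimension, and adjoining
      \<open>p\<close> gains one. If \<open>U\<close> is not inside \<open>W\<close>, both
      \<open>U\<close> and \<open>?T\<close> arise from \<open>?N\<close> by adjoining one
      vector.\<close>
    have le: "sdim K V U \<le> sdim K V ?T"
    proof (cases "U \<subseteq> W")
      case True
      then show ?thesis using sdim_adjoin[OF N p(1) pN] by (simp add: Int_absorb2)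
    next
      case False
      then obtain h where h: "h \<in> U" "b h p \<noteq> \<zero>\<^bsub>K\<^esub>" using U.subset mem_W by blast
      then have "h \<notin> ?N" by (simp add: mem_W)
      moreover have "h \<in> carrier V" using h(1) U.subset by auto
      ultimately have "sdim K V (adjoin ?N h) = sdim K V ?T"
        using sdim_adjoin[OF N] p(1) pN by simp
      then show ?thesis using eq_adjoin_Int_W[OF sub h] by (metis order_refl)
    qed
    \<comment> \<open>Every vector of \<open>?T\<close> lies in a coset of \<open>P\<close>
      represented in \<open>?N\<close>, so constancy on cosets reduces the claims to
      \<open>U\<close>.\<close>
    have form: "\<exists>n x. n \<in> P \<and> x \<in> ?N \<and> u = n \<oplus>\<^bsub>V\<^esub> x" if "u \<in> ?T" for u
      using that by (auto simp: adjoin_def mem_P)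
    have pc: "n \<in> carrier V" if "n \<in> P" for n using that P_subset_W W_carrier by auto
    have uc: "x \<in> carrier V" if "x \<in> U" for x using that U.subset by auto
    have "singular K F u" if u: "u \<in> ?T" for u
    proof -
      obtain n x where nx: "n \<in> P" "x \<in> ?N" "u = n \<oplus>\<^bsub>V\<^esub> x" using form[OF u] by blast
      then have "u \<in> \<langle>x\<rangle>" by (auto simp: mem_coset)
      then show ?thesis using singular_coset(1)[of x u] nx(2) sing by auto
    qed
    moreover have "b u v = \<zero>\<^bsub>K\<^esub>" if u: "u \<in> ?T" and v: "v \<in> ?T" for u v
    proof -
      obtain n x where nx: "n \<in> P" "x \<in> ?N" "u = n \<oplus>\<^bsub>V\<^esub> x" using form[OF u] by blast
      obtain m y where my: "m \<in> P" "y \<in> ?N" "v = m \<oplus>\<^bsub>V\<^esub> y" using form[OF v] by blast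
      have "u \<in> \<langle>x\<rangle>" "v \<in> \<langle>y\<rangle>" using nx my by (auto simp: mem_coset)
      then show ?thesis using pairing_const[of x y u v] nx(2) my(2) orth by auto
    qed
    ultimately have TP: "?T \<in> polar_subspaces K V F" using T(1) by (simp add: polar_subspaces_eq)
    then have "sdim K V ?T = polar_rank K V F"
      using le sdim_le_rank U(2) by (metis le_antisym)
    moreover have "P \<subseteq> ?T"
      using T(3) submodule.smult_closed[OF is_module[OF T(1)]] by (auto simp: mem_P)
    ultimately show thesis using that TP by blast
  qed
qed

text \<open>Passing to the quotient lowers each dimension by one, and the maximum over all subspaces
  is already attained by one through \<open>P\<close>.\<close>

lemma polar_rank_induced: "polar_rank K V F = Suc (polar_rank K R F')"
proof -
  obtain U where U: "U \<in> polar_subspaces K V F" "P \<subseteq> U" "sdim K V U = polar_rank K V F"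
    by (rule max_polar_subspace_at_point)
  have dim: "sdim K V U = Suc (sdim K R (coset ` U))"
    if "U \<in> polar_subspaces K V F" "P \<subseteq> U" for U
    using that sdim_image polar_subspace_image by (simp add: polar_subspaces_def)
  have "polar_rank K R F' = sdim K R (coset ` U)"
    unfolding polar_rank_def
  proof (rule Max_eqI)
    have "polar_subspaces K R F' \<subseteq> (\<lambda>U. coset ` U) ` polar_subspaces K V F"
      using polar_subspace_obtains by blast
    then show "finite (sdim K R ` polar_subspaces K R F')"
      using finite_polar_subspaces finite_surj by blast
    show "sdim K R (coset ` U) \<in> sdim K R ` polar_subspaces K R F'"
      using polar_subspace_image U by blast
    fix d assume "d \<in> sdim K R ` polar_subspaces K R F'"
    then obtain S where S: "S \<in> polar_subspaces K R F'" "d = sdim K R S" by auto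
    obtain T where "T \<in> polar_subspaces K V F" "P \<subseteq> T" "S = coset ` T"
      using polar_subspace_obtains[OF S(1)] .
    then show "d \<le> sdim K R (coset ` U)"
      using dim[of T] dim[of U] U S(2) sdim_le_rank[of T] by simp
  qed
  then show ?thesis using dim[of U] U by simp
qed

text \<open>The kind of form and the field stay the same. The dimension drops by two and the rank by
  one, so the excess of the dimension over twice the rank is preserved.\<close>

lemma has_type_induced:
  assumes "has_type K V F Q"
  shows "has_type K R F' Q"
proof -
  have "is_Alternating F' = is_Alternating F" "is_Hermitian F' = is_Hermitian F"
    "is_Quadratic F' = is_Quadratic F" by (cases F; simp)+
  then show ?thesis
    using assms dim_R polar_rank_induced by (cases Q) auto
qed

text \<open>By \<open>polar_rank_induced\<close> the rank \<open>r\<close> is a successor, so the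
  truncated subtraction is exact.\<close>

lemma polar_space_residue:
  assumes "polar_space K V F Q r"
  shows "polar_space K R F' Q (r - 1)"
proof -
  interpret Q: vectorspace K R by (rule vectorspace_R)
  have "finite W" using finite_V W_carrier by (auto intro: finite_subset)
  then have "Q.fin_dim" by (intro Q.finite_imp_fin_dim) (simp add: carrier_R)
  then show ?thesis
    using assms vectorspace_R finite_field wf_induced nondegenerate_induced has_type_induced
      polar_rank_induced unfolding polar_space_def by fastforce
qed

lemma polar_subspaces_dim_R:
  "polar_subspaces_dim K R F' d = (\<lambda>U. coset ` U) ` {U \<in> polar_subspaces_dim K V F (Suc d). P \<subseteq> U}"
proof (intro equalityI subsetI)
  fix S assume "S \<in> polar_subspaces_dim K R F' d"
  then have S: "S \<in> polar_subspaces K R F'" "sdim K R S = d" by (auto simp: polar_subspaces_dim_def)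
  obtain U where "U \<in> polar_subspaces K V F" "P \<subseteq> U" "S = coset ` U"
    using polar_subspace_obtains[OF S(1)] .
  then show "S \<in> (\<lambda>U. coset ` U) ` {U \<in> polar_subspaces_dim K V F (Suc d). P \<subseteq> U}"
    using S(2) sdim_image[of U] polar_subspace_image[of U]
    by (auto simp: polar_subspaces_dim_def polar_subspaces_def)
next
  fix S assume "S \<in> (\<lambda>U. coset ` U) ` {U \<in> polar_subspaces_dim K V F (Suc d). P \<subseteq> U}"
  then obtain U where "U \<in> polar_subspaces K V F" "sdim K V U = Suc d" "P \<subseteq> U" "S = coset ` U"
    by (auto simp: polar_subspaces_dim_def)
  then show "S \<in> polar_subspaces_dim K R F' d"
    using sdim_image[of U] polar_subspace_image[of U]
    by (auto simp: polar_subspaces_dim_def polar_subspaces_def)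
qed

end

section \<open>The derived design\<close>

text \<open>Lift a subspace \<open>T'\<close> of the residue to \<open>T\<close> through
  \<open>P\<close>. The derived blocks above \<open>T'\<close> then correspond bijectively to the
  blocks of \<open>D\<close> above \<open>T\<close>.\<close>

lemma (in polar_point) polar_design_derived:
  assumes D: "polar_design K V F Q t r k l D" and t: "1 \<le> t" and k: "1 \<le> k"
  shows "polar_design K R F' Q (t - 1) (r - 1) (k - 1) l (derived_design V P D)"
  unfolding polar_design_def
proof (intro conjI ballI)
  have D_sub: "D \<subseteq> polar_subspaces_dim K V F k" using D by (simp add: polar_design_def)
  have der: "derived_design V P D = (\<lambda>B. coset ` B) ` {B \<in> D. P \<subseteq> B}"
    by (auto simp: derived_design_def quotient_set_eq)
  show "polar_space K R F' Q (r - 1)"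
    using D polar_space_residue by (simp add: polar_design_def)
  show "t - 1 \<le> r - 1" "k - 1 \<le> r - 1" using D by (simp_all add: polar_design_def diff_le_mono)
  show "derived_design V P D \<subseteq> polar_subspaces_dim K R F' (k - 1)"
    unfolding der polar_subspaces_dim_R using D_sub k by auto
  fix T' assume "T' \<in> polar_subspaces_dim K R F' (t - 1)"
  then obtain T where T: "T \<in> polar_subspaces_dim K V F t" "P \<subseteq> T" "T' = coset ` T"
    using t by (auto simp: polar_subspaces_dim_R)
  \<comment> \<open>The dimension is left general because the fact serves both \<open>T\<close>, of
    dimension \<open>t\<close>, and the blocks, of dimension \<open>k\<close>.\<close>
  have sub: "subspace K B V" "B \<subseteq> W" if "B \<in> polar_subspaces_dim K V F d" "P \<subseteq> B" for B d
    using that polar_subspace_image(1)[of B] by (auto simp: polar_subspaces_dim_def polar_subspaces_def)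
  have TW: "T \<subseteq> W" using sub(2) T(1,2) .
  have iff: "coset ` T \<subseteq> coset ` B \<longleftrightarrow> T \<subseteq> B" if "B \<in> D" "P \<subseteq> B" for B
    by (rule image_subset_iff_R[OF _ that(2) _ TW]) (rule sub[OF subsetD[OF D_sub that(1)] that(2)])+
  have "{B' \<in> derived_design V P D. T' \<subseteq> B'} =
      (\<lambda>B. coset ` B) ` {B \<in> D. P \<subseteq> B \<and> coset ` T \<subseteq> coset ` B}"
    unfolding der T(3) by blast
  \<comment> \<open>Blocks containing \<open>T\<close> pass through \<open>P\<close>
    automatically.\<close>
  moreover have "{B \<in> D. P \<subseteq> B \<and> coset ` T \<subseteq> coset ` B} = {B \<in> D. T \<subseteq> B}"
    using iff subset_trans[OF T(2)] by blast
  ultimately have "{B' \<in> derived_design V P D. T' \<subseteq> B'} = (\<lambda>B. coset ` B) ` {B \<in> D. T \<subseteq> B}"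
    by (simp only:)
  \<comment> \<open>Distinct blocks must not be merged in the derived design; equal images give
    inclusions in both directions.\<close>
  moreover have "inj_on (\<lambda>B. coset ` B) {B \<in> D. P \<subseteq> B}"
  proof (rule inj_onI)
    fix A B assume "A \<in> {B \<in> D. P \<subseteq> B}" "B \<in> {B \<in> D. P \<subseteq> B}" and eq: "coset ` A = coset ` B"
    then have A: "A \<in> D" "P \<subseteq> A" and B: "B \<in> D" "P \<subseteq> B" by blast+
    note sA = sub[OF subsetD[OF D_sub A(1)] A(2)] and sB = sub[OF subsetD[OF D_sub B(1)] B(2)]
    have "A \<subseteq> B" "B \<subseteq> A"
      using image_subset_iff_R[OF sB(1) B(2) sB(2) sA(2)]
        image_subset_iff_R[OF sA(1) A(2) sA(2) sB(2)] eq by blast+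
    then show "A = B" ..
  qed
  then have "inj_on (\<lambda>B. coset ` B) {B \<in> D. T \<subseteq> B}"
    by (rule inj_on_subset) (use T(2) in auto)
  ultimately have "card {B' \<in> derived_design V P D. T' \<subseteq> B'} = card {B \<in> D. T \<subseteq> B}"
    by (simp add: card_image)
  then show "card {B' \<in> derived_design V P D. T' \<subseteq> B'} = l"
    using D T(1) by (simp add: polar_design_def)
qed

theorem theorem6:
  fixes K :: "('k, 'm) ring_scheme"
    and V :: "('k, 'v, 'n) module_scheme"
    and F :: "('k, 'v) form"
    and Q :: polar_type
    and r t k l :: nat
    and D :: "'v set set"
    and P :: "'v set"
  assumes "polar_space K V F Q r" and "r \<ge> 1"
    and "1 \<le> t" and "t \<le> k" and "k \<le> r"
    and "polar_design K V F Q t r k l D"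
    and "P \<in> polar_subspaces_dim K V F 1"
  shows "polar_design K (residue_space K V F P) (induced_form F) Q
           (t - 1) (r - 1) (k - 1) l (derived_design V P D)"
proof -
  have vs: "vectorspace K V" and K_fin: "finite (carrier K)" and fd: "vectorspace.fin_dim K V"
    and wf: "wf_form K V F" and nondeg: "nondegenerate K V F"
    using assms(1) by (simp_all add: polar_space_def)
  interpret formed_space K V F
    using vs wf by (simp add: formed_space_def formed_space_axioms_def)
  have P: "subspace K P V" "\<forall>u\<in>P. singular K F u" "sdim K V P = 1"
    using assms(7) by (simp_all add: polar_subspaces_dim_def polar_subspaces_eq)
  interpret P: submodule K P V by (rule is_module[OF P(1)])
  have fin_V: "finite (carrier V)" using card_carrier K_fin fd by blast
  have card_P: "card P = order K" using card_subspace[OF K_fin fin_V P(1)] P(3) by simp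
  \<comment> \<open>Counting supplies a generator: a point has more than one vector, and the span of
    a nonzero one lies in \<open>P\<close> and has the same finite size.\<close>
  then have "1 < card P" using order_field_gt_1[OF K_fin] by simp
  then have "\<not> P \<subseteq> {\<zero>\<^bsub>V\<^esub>}"
    using card_mono[of "{\<zero>\<^bsub>V\<^esub>}" P] by auto
  then obtain p where p: "p \<in> P" "p \<noteq> \<zero>\<^bsub>V\<^esub>" by blast
  have pV: "p \<in> carrier V" using p(1) P.subset by blast
  have zero: "subspace K {\<zero>\<^bsub>V\<^esub>} V" by (rule subspaceI) auto
  have "adjoin {\<zero>\<^bsub>V\<^esub>} p \<subseteq> P" using p(1) by (auto simp: adjoin_def)
  moreover have "card (adjoin {\<zero>\<^bsub>V\<^esub>} p) = card P"
    using card_adjoin[OF zero pV] p(2) card_P by simp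
  moreover have "finite P" using finite_subset[OF P.subset fin_V] .
  ultimately have "P = adjoin {\<zero>\<^bsub>V\<^esub>} p" by (metis card_subset_eq)
  then interpret polar_point K V F p P
    using K_fin fd nondeg pV p P(2) formed_space_axioms
    by (simp add: polar_point_def polar_point_axioms_def)
  show ?thesis using polar_design_derived assms by simp
qed

end
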